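(* Let $\mathbf{d}_\kappa=(d_{i\kappa})_{i=1}^{n_\kappa}$, $\kappa\ge 1$, be finite sequences of integers and let $m_\kappa$ be integers with $0\le m_\kappa\le n_\kappa$. With $\bar d_\kappa$, $Q_\kappa$, $\widehat\sigma_\kappa^2$, $p_k(\mathbf{d}_\kappa)$ and $S_{m_\kappa}$ as defined in the context, assume that $Q_\kappa>0$ for all $\kappa$ and that, as $\kappa\to\infty$: (1) $n_\kappa\to\infty$; (2) for every $k\in\mathbb{Z}$, $p_k(\mathbf{d}_\kappa)\to p_k$, where $\mathbf{p}=(p_k)_{k\in\mathbb{Z}}$ is a probability distribution on $\mathbb{Z}$ which is nonlattice; (3) $Q_\kappa=O(n_\kappa)$; (4) for every $\varepsilon>0$, $$\frac{1}{Q_\kappa}\sum_{i:\,|d_{i\kappa}-\bar d_\kappa|>\varepsilon\widehat\sigma_\kappa}(d_{i\kappa}-\bar d_\kappa)^2\to 0.$$ Then, as $\kappa\to\infty$, uniformly for all $k\in\mathbb{Z}$, $$\mathbb{P}(S_{m_\kappa}=k)=\frac{1}{\sqrt{2\pi\widehat\sigma_\kappa^2}}\left(\exp\left(-\frac{(k-m_\kappa\bar d_\kappa)^2}{2\widehat\sigma_\kappa^2}\right)+o(1)\right).$$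
   Context: $S_{m_\kappa}$ is the sum of $m_\kappa$ of the values $d_{1\kappa},\dots,d_{n_\kappa\kappa}$ obtained by drawing without replacement: $S_{m_\kappa}=\sum_{i=1}^{m_\kappa}d_{\tau(i)\kappa}$ with $\tau$ a uniformly random permutation of $\{1,\dots,n_\kappa\}$. Further, $$\bar d_\kappa=\frac1{n_\kappa}\sum_{i=1}^{n_\kappa}d_{i\kappa},\qquad Q_\kappa=\sum_{i=1}^{n_\kappa}(d_{i\kappa}-\bar d_\kappa)^2,\qquad \widehat\sigma_\kappa^2=\frac{m_\kappa}{n_\kappa}\Bigl(1-\frac{m_\kappa}{n_\kappa}\Bigr)Q_\kappa,$$ with $\widehat\sigma_\kappa\ge0$, and $p_k(\mathbf{d}_\kappa)=\#\{1\le i\le n_\kappa: d_{i\kappa}=k\}/n_\kappa$ for $k\in\mathbb{Z}$. A probability distribution $\mathbf{p}$ on $\mathbb{Z}$ is nonlattice if its span, i.e. $\gcd\{i-j: p_i>0,\ p_j>0\}$ (taken to be $\infty$ if $\mathbf{p}$ is concentrated at a single point), equals $1$. *)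

theory Defs
  imports "HOL-Probability.Probability"
begin

text \<open>A finite integer sequence $d_1, \dots, d_n$ is given by its length \<open>n\<close> and a function
  \<open>d :: nat \<Rightarrow> int\<close>, of which only the values on \<open>{1..n}\<close> matter.\<close>

definition seq_mean :: "nat \<Rightarrow> (nat \<Rightarrow> int) \<Rightarrow> real" where
  "seq_mean n d = (1 / real n) * (\<Sum>i=1..n. real_of_int (d i))"

definition seq_Q :: "nat \<Rightarrow> (nat \<Rightarrow> int) \<Rightarrow> real" where
  "seq_Q n d = (\<Sum>i=1..n. (real_of_int (d i) - seq_mean n d)\<^sup>2)"

definition sigma_hat_sq :: "nat \<Rightarrow> nat \<Rightarrow> (nat \<Rightarrow> int) \<Rightarrow> real" where
  "sigma_hat_sq m n d = (real m / real n) * (1 - real m / real n) * seq_Q n d"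

definition sigma_hat :: "nat \<Rightarrow> nat \<Rightarrow> (nat \<Rightarrow> int) \<Rightarrow> real" where
  "sigma_hat m n d = sqrt (sigma_hat_sq m n d)"

definition rel_freq :: "nat \<Rightarrow> (nat \<Rightarrow> int) \<Rightarrow> int \<Rightarrow> real" where
  "rel_freq n d k = real (card {i \<in> {1..n}. d i = k}) / real n"

definition random_permutation :: "nat \<Rightarrow> (nat \<Rightarrow> nat) pmf" where
  "random_permutation n = pmf_of_set {\<tau>. \<tau> permutes {1..n}}"

definition sample_sum :: "nat \<Rightarrow> (nat \<Rightarrow> int) \<Rightarrow> (nat \<Rightarrow> nat) \<Rightarrow> int" where
  "sample_sum m d \<tau> = (\<Sum>i=1..m. d (\<tau> i))"

text \<open>For a distribution concentrated at a single point the set of differences is \<open>{0}\<close>, whose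
  library \<open>Gcd\<close> is 0; the convention for the span is \<open>\<infinity>\<close>.\<close>

definition span_pmf :: "int pmf \<Rightarrow> enat" where
  "span_pmf p = (if \<exists>a. set_pmf p = {a} then \<infinity>
     else enat (nat (Gcd {i - j | i j. pmf p i > 0 \<and> pmf p j > 0})))"

definition nonlattice :: "int pmf \<Rightarrow> bool" where
  "nonlattice p \<longleftrightarrow> span_pmf p = 1"

end

theory Submission
  imports Defs "HOL-Computational_Algebra.Group_Closure"
begin

text \<open>The sampled indices form a uniformly random \<open>m\<close>-element subset of \<open>{1..n}\<close>, and such a subset
  is what remains of \<open>n\<close> independent coin tosses with success probability \<open>q = m / n\<close> when the
  number of successes is conditioned to equal \<open>m\<close>. On the Fourier side, conditioning is an
  integration over one more frequency: with \<open>a\<^sub>i\<close> the deviations from the mean, the characteristic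
  function of the centred sample sum at \<open>t\<close> is proportional to the integral over one period in \<open>s\<close>
  of \<open>\<Prod>\<^sub>i g (s + t a\<^sub>i)\<close>, where \<open>g\<close> is the characteristic function of a centred Bernoulli variable
  (lemma \<open>lborel_integral_bern_prod\<close>). The constant of proportionality needs no separate estimate,
  being determined by \<open>t = 0\<close>.

  After the scaling \<open>s = w / v\<close>, \<open>t = u / \<sigma>\<close> with \<open>v\<^sup>2 = n q (1 - q)\<close>, the Gaussian factors
  that match \<open>g\<close> to second order multiply to exactly \<open>exp (- (w\<^sup>2 + u\<^sup>2) / 2)\<close>, because the deviations
  sum to zero; the error is controlled by the Lindeberg sum (\<open>norm_bern_prod_minus_gauss\<close>). For
  dominated convergence, \<open>\<bar>g x\<bar> \<le> exp (- q (1 - q) (1 - cos x))\<close> and, as the limiting distribution is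
  nonlattice, \<open>\<Sum>\<^sub>i (1 - cos (s + t d\<^sub>i)) \<ge> c n (s\<^sup>2 + t\<^sup>2)\<close> for \<open>\<bar>s\<bar>, \<bar>t\<bar> \<le> \<pi>\<close>
  (\<open>eventually_sum_cos_ge\<close>). Dominated convergence in \<open>w\<close> gives the pointwise limit
  \<open>exp (- u\<^sup>2 / 2)\<close> of the characteristic function of the standardized sample sum, together
  with a Gaussian majorant on \<open>\<bar>u\<bar> \<le> \<pi> \<sigma>\<close>; dominated convergence in \<open>u\<close> gives convergence in
  \<open>L\<^sup>1\<close> (\<open>cf_L1_tendsto\<close>), which bounds the error of all point probabilities at once by
  Fourier inversion.\<close>

section \<open>Centred sequences\<close>

definition deviation :: "nat \<Rightarrow> (nat \<Rightarrow> int) \<Rightarrow> nat \<Rightarrow> real" where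
  "deviation n d i = real_of_int (d i) - seq_mean n d"

lemma sum_int_eq_mean: "(\<Sum>i=1..n. real_of_int (d i)) = real n * seq_mean n d"
  by (cases "n = 0") (simp_all add: seq_mean_def)

lemma sum_deviation: "(\<Sum>i=1..n. deviation n d i) = 0"
  by (simp only: deviation_def sum_subtractf sum_int_eq_mean) simp

lemma seq_Q_eq: "seq_Q n d = (\<Sum>i=1..n. (deviation n d i)\<^sup>2)"
  by (simp add: seq_Q_def deviation_def)

text \<open>The mixed term vanishes because the deviations sum to zero. This is what decouples the
  frequency \<open>s\<close> of the number of successes from the frequency \<open>t\<close> of the sum.\<close>
lemma sum_sq_affine_deviation:
  "(\<Sum>i=1..n. (s + t * deviation n d i)\<^sup>2) = n * s\<^sup>2 + t\<^sup>2 * seq_Q n d"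
proof -
  have "(\<Sum>i=1..n. (s + t * deviation n d i)\<^sup>2)
      = (\<Sum>i=1..n. s\<^sup>2 + 2 * s * t * deviation n d i + t\<^sup>2 * (deviation n d i)\<^sup>2)"
    by (intro sum.cong) (auto simp: power2_eq_square algebra_simps)
  also have "\<dots> = n * s\<^sup>2 + 2 * s * t * (\<Sum>i=1..n. deviation n d i) + t\<^sup>2 * seq_Q n d"
    by (simp add: sum.distrib sum_distrib_left seq_Q_eq)
  finally show ?thesis by (simp add: sum_deviation[unfolded One_nat_def])
qed

section \<open>Sampling as a uniformly random subset\<close>

lemma ex_permutes_image_eq:
  assumes "finite S" "A \<subseteq> S" "B \<subseteq> S" "card A = card B"
  obtains \<pi> where "\<pi> permutes S" "\<pi> ` A = B"
proof -
  have fin: "finite A" "finite B" using assms finite_subset by auto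
  have "card (S - A) = card (S - B)"
    using assms fin by (simp add: card_Diff_subset)
  then obtain g where g: "bij_betw g (S - A) (S - B)"
    using assms(1) by (metis finite_Diff finite_same_card_bij)
  obtain f where f: "bij_betw f A B"
    using assms(4) fin by (metis finite_same_card_bij)
  define \<pi> where "\<pi> x = (if x \<in> A then f x else if x \<in> S then g x else x)" for x
  have "bij_betw \<pi> A B"
    using f by (rule bij_betw_cong[THEN iffD1, rotated]) (simp add: \<pi>_def)
  moreover have "bij_betw \<pi> (S - A) (S - B)"
    using g by (rule bij_betw_cong[THEN iffD1, rotated]) (simp add: \<pi>_def)
  ultimately have "bij_betw \<pi> (A \<union> (S - A)) (B \<union> (S - B))"
    by (rule bij_betw_combine) auto
  then have "bij_betw \<pi> S S"
    using assms(2,3) by (simp add: Un_absorb1)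
  moreover have "\<pi> x = x" if "x \<notin> S" for x
    using that assms(2) by (auto simp: \<pi>_def)
  ultimately have "\<pi> permutes S"
    by (rule bij_imp_permutes)
  moreover have "\<pi> ` A = B"
    using \<open>bij_betw \<pi> A B\<close> by (simp add: bij_betw_def)
  ultimately show thesis by (rule that)
qed

text \<open>All fibres of \<open>\<tau> \<mapsto> \<tau> ` A\<close> have the same size, since composition with a permutation that maps
  \<open>A\<close> to \<open>B\<close> carries the fibre over \<open>A\<close> to the fibre over \<open>B\<close>. Hence a uniformly random permutation
  has a uniformly random image of \<open>A\<close>.\<close>
lemma card_permutes_image_in:
  assumes "finite S" "A \<subseteq> S" "F \<subseteq> {B. B \<subseteq> S \<and> card B = card A}"
  shows "card {\<tau>. \<tau> permutes S \<and> \<tau> ` A \<in> F}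
       = card F * card {\<tau>. \<tau> permutes S \<and> \<tau> ` A = A}"
proof -
  let ?fib = "\<lambda>B. {\<tau>. \<tau> permutes S \<and> \<tau> ` A = B}"
  have fin: "finite {\<tau>. \<tau> permutes S}" by (rule finite_permutations[OF assms(1)])
  have "finite F"
    using assms(1,3) by (auto intro: finite_subset[of _ "Pow S"])
  have fib: "card (?fib B) = card (?fib A)" if "B \<in> F" for B
  proof -
    from that assms(3) have B: "B \<subseteq> S" "card A = card B" by auto
    obtain \<pi> where \<pi>: "\<pi> permutes S" "\<pi> ` A = B"
      by (rule ex_permutes_image_eq[OF assms(1,2) B])
    have inv: "inv \<pi> ` B = A"
      unfolding \<pi>(2)[symmetric] by (simp add: image_image permutes_inverses(2)[OF \<pi>(1)])
    have comp: "\<sigma> \<circ> \<tau> \<in> ?fib (\<sigma> ` C)" if "\<sigma> permutes S" "\<tau> \<in> ?fib C" for \<sigma> \<tau> C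
      using that permutes_compose[of \<tau> S \<sigma>] image_comp[of \<sigma> \<tau> A] by auto
    have "bij_betw ((\<circ>) \<pi>) (?fib A) (?fib B)"
    proof (rule bij_betw_byWitness[where f' = "(\<circ>) (inv \<pi>)"])
      show "(\<circ>) \<pi> ` ?fib A \<subseteq> ?fib B"
        by (rule image_subsetI) (use comp[OF \<pi>(1), of _ A] \<pi>(2) in simp)
      show "(\<circ>) (inv \<pi>) ` ?fib B \<subseteq> ?fib A"
        by (rule image_subsetI) (use comp[OF permutes_inv[OF \<pi>(1)], of _ B] inv in simp)
      show "\<forall>\<tau>\<in>?fib A. inv \<pi> \<circ> (\<pi> \<circ> \<tau>) = \<tau>" "\<forall>\<tau>\<in>?fib B. \<pi> \<circ> (inv \<pi> \<circ> \<tau>) = \<tau>"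
        using permutes_inv_o[OF \<pi>(1)] by (simp_all add: o_assoc)
    qed
    then show ?thesis by (simp add: bij_betw_same_card)
  qed
  have "card {\<tau>. \<tau> permutes S \<and> \<tau> ` A \<in> F} = card (\<Union>B\<in>F. ?fib B)"
    by (intro arg_cong[where f = card]) auto
  also have "\<dots> = (\<Sum>B\<in>F. card (?fib B))"
    by (rule card_UN_disjoint) (use \<open>finite F\<close> fin in \<open>auto intro: finite_subset[OF _ fin]\<close>)
  also have "\<dots> = card F * card (?fib A)"
    using fib by simp
  finally show ?thesis .
qed

lemma prob_sample_sum:
  assumes "m \<le> n"
  shows "measure_pmf.prob (random_permutation n) {\<tau>. sample_sum m d \<tau> = k}
    = card {A. A \<subseteq> {1..n} \<and> card A = m \<and> (\<Sum>i\<in>A. d i) = k} / (n choose m)"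
proof -
  let ?S = "{1..n}" and ?I = "{1..m}"
  let ?P = "{\<tau>. \<tau> permutes ?S}"
  let ?F = "{A. A \<subseteq> ?S \<and> card A = m \<and> (\<Sum>i\<in>A. d i) = k}"
  let ?c = "card {\<tau>. \<tau> permutes ?S \<and> \<tau> ` ?I = ?I}"
  have I: "?I \<subseteq> ?S" using assms by auto
  have P: "finite ?P" "?P \<noteq> {}"
    using finite_permutations[of ?S] permutes_id by blast+
  have inj: "inj_on \<tau> ?I" if "\<tau> permutes ?S" for \<tau>
    using permutes_inj_on[OF that] by blast
  have img: "\<tau> ` ?I \<subseteq> ?S \<and> card (\<tau> ` ?I) = m" if "\<tau> permutes ?S" for \<tau>
    using I permutes_image[OF that] card_image[OF inj[OF that]] by auto
  have sum: "sample_sum m d \<tau> = (\<Sum>i\<in>\<tau> ` ?I. d i)" if "\<tau> permutes ?S" for \<tau>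
    using inj[OF that] by (simp add: sample_sum_def sum.reindex)
  have "card (?P \<inter> {\<tau>. sample_sum m d \<tau> = k}) = card {\<tau>. \<tau> permutes ?S \<and> \<tau> ` ?I \<in> ?F}"
    using img sum by (intro arg_cong[where f = card]) auto
  also have "\<dots> = card ?F * ?c"
    by (rule card_permutes_image_in) (use I in auto)
  finally have num: "card (?P \<inter> {\<tau>. sample_sum m d \<tau> = k}) = card ?F * ?c" .
  have "card ?P = card {\<tau>. \<tau> permutes ?S \<and> \<tau> ` ?I \<in> {A. A \<subseteq> ?S \<and> card A = m}}"
    using img by (intro arg_cong[where f = card]) auto
  also have "\<dots> = card {A. A \<subseteq> ?S \<and> card A = m} * ?c"
    by (rule card_permutes_image_in) (use I in auto)
  also have "card {A. A \<subseteq> ?S \<and> card A = m} = n choose m"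
    by (simp add: n_subsets)
  finally have den: "card ?P = (n choose m) * ?c" .
  have "card ?P \<noteq> 0" using P by (metis card_0_eq)
  then have "?c \<noteq> 0" unfolding den by (rule contrapos_nn) simp
  have "measure_pmf.prob (random_permutation n) {\<tau>. sample_sum m d \<tau> = k}
      = card (?P \<inter> {\<tau>. sample_sum m d \<tau> = k}) / card ?P"
    unfolding random_permutation_def by (rule measure_pmf_of_set[OF P(2,1)])
  also have "\<dots> = card ?F / (n choose m)"
    unfolding num den using \<open>?c \<noteq> 0\<close> by simp
  finally show ?thesis .
qed

section \<open>The characteristic function of a centred Bernoulli variable\<close>

definition bern_cf :: "real \<Rightarrow> real \<Rightarrow> complex" where
  "bern_cf q x = of_real q * iexp ((1 - q) * x) + of_real (1 - q) * iexp (- (q * x))"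

lemma bern_cf_eq: "bern_cf q x = iexp (- (q * x)) * (of_real q * iexp x + of_real (1 - q))"
proof -
  have "iexp ((1 - q) * x) = iexp (- (q * x)) * iexp x"
    by (simp add: exp_add[symmetric] algebra_simps)
  then show ?thesis by (simp add: bern_cf_def algebra_simps)
qed

lemma norm_bern_cf_sq: "(norm (bern_cf q x))\<^sup>2 = 1 - 2 * q * (1 - q) * (1 - cos x)"
proof -
  have "norm (bern_cf q x) = norm (of_real q * iexp x + of_real (1 - q))"
    by (simp add: bern_cf_eq norm_mult)
  also have "(\<dots>)\<^sup>2 = (q * cos x + (1 - q))\<^sup>2 + (q * sin x)\<^sup>2"
    by (simp add: cmod_power2 Re_exp Im_exp)
  also have "\<dots> = q\<^sup>2 * ((cos x)\<^sup>2 + (sin x)\<^sup>2) + 2 * q * (1 - q) * cos x + (1 - q)\<^sup>2"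
    by algebra
  also have "\<dots> = 1 - 2 * q * (1 - q) * (1 - cos x)"
    unfolding sin_cos_squared_add2 by (simp add: power2_eq_square algebra_simps)
  finally show ?thesis .
qed

text \<open>Apply \<open>1 - y \<le> exp (- y)\<close> to the exact formula for the squared modulus.\<close>
lemma norm_bern_cf_le: "norm (bern_cf q x) \<le> exp (- (q * (1 - q) * (1 - cos x)))"
proof (rule power2_le_imp_le)
  have "(norm (bern_cf q x))\<^sup>2 = 1 + (- (2 * q * (1 - q) * (1 - cos x)))"
    by (simp add: norm_bern_cf_sq)
  also have "\<dots> \<le> exp (- (2 * q * (1 - q) * (1 - cos x)))"
    by (rule exp_ge_add_one_self)
  also have "\<dots> = (exp (- (q * (1 - q) * (1 - cos x))))\<^sup>2"
    unfolding exp_double[symmetric] by (simp add: algebra_simps)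
  finally show "(norm (bern_cf q x))\<^sup>2 \<le> (exp (- (q * (1 - q) * (1 - cos x))))\<^sup>2" .
qed simp

lemma norm_bern_cf_le_1: "0 \<le> q \<Longrightarrow> q \<le> 1 \<Longrightarrow> norm (bern_cf q x) \<le> 1"
  by (rule order_trans[OF norm_bern_cf_le]) simp

text \<open>The factor \<open>min 1 \<bar>x\<bar>\<close> keeps the error integrable against second moments only: the cubic bound
  serves for small \<open>x\<close>, the quadratic one for the terms that the Lindeberg condition controls.\<close>
lemma norm_iexp_minus_quadratic:
  "norm (iexp x - (1 + \<i> * x - x\<^sup>2 / 2)) \<le> x\<^sup>2 * min 1 \<bar>x\<bar>"
proof -
  have sum: "(\<Sum>k\<le>2. (\<i> * x) ^ k / fact k) = 1 + \<i> * x - x\<^sup>2 / 2"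
    by (simp add: numeral_2_eq_2 power_mult_distrib)
  have "norm (iexp x - (1 + \<i> * x - x\<^sup>2 / 2)) \<le> x\<^sup>2"
    using iexp_approx2[of x 2] unfolding sum by (simp add: fact_numeral)
  moreover have "norm (iexp x - (1 + \<i> * x - x\<^sup>2 / 2)) \<le> x\<^sup>2 * \<bar>x\<bar>"
  proof -
    have "norm (iexp x - (1 + \<i> * x - x\<^sup>2 / 2)) \<le> \<bar>x\<bar> ^ Suc 2 / fact (Suc 2)"
      using iexp_approx1[of x 2] unfolding sum .
    also have "\<dots> \<le> \<bar>x\<bar> ^ Suc 2 / 1"
      by (intro divide_left_mono) (auto simp: fact_numeral)
    also have "\<dots> = x\<^sup>2 * \<bar>x\<bar>" by (simp add: eval_nat_numeral)
    finally show ?thesis .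
  qed
  ultimately show ?thesis by (simp add: min_def)
qed

lemma exp_minus_linear_bound:
  fixes y :: real
  assumes "0 \<le> y"
  shows "\<bar>exp (- y) - (1 - y)\<bar> \<le> min y (y\<^sup>2)"
proof -
  have "1 - y \<le> exp (- y)" using exp_ge_add_one_self[of "-y"] by simp
  moreover have "exp (- y) \<le> 1" using assms by simp
  moreover have "exp (- y) \<le> 1 - y + y\<^sup>2"
  proof -
    have "exp (- y) \<le> 1 / (1 + y)"
      using exp_ge_add_one_self[of y] assms by (simp add: exp_minus field_simps)
    also have "\<dots> \<le> 1 - y + y\<^sup>2"
      using assms by (simp add: field_simps power2_eq_square)
    finally show ?thesis .
  qed
  ultimately show ?thesis by (simp add: abs_if min_def)
qed

lemma norm_bern_cf_minus_gauss:
  assumes q: "0 \<le> q" "q \<le> 1"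
  shows "norm (bern_cf q x - of_real (exp (- (q * (1 - q) * x\<^sup>2 / 2)))) \<le> 2 * (q * (1 - q)) * (x\<^sup>2 * min 1 \<bar>x\<bar>)"
proof -
  define V where "V = q * (1 - q)"
  define B where "B = x\<^sup>2 * min 1 \<bar>x\<bar>"
  have V: "0 \<le> V" "V \<le> 1" 
    using q by (auto simp: V_def intro!: mult_le_one)
  have B: "0 \<le> B" by (simp add: B_def)
  have scaled: "norm (iexp (a * x) - (1 + \<i> * (a * x) - (a * x)\<^sup>2 / 2)) \<le> a\<^sup>2 * B"
    if a: "\<bar>a\<bar> \<le> 1" for a
  proof -
    have "norm (iexp (a * x) - (1 + \<i> * (a * x) - (a * x)\<^sup>2 / 2)) \<le> (a * x)\<^sup>2 * min 1 \<bar>a * x\<bar>"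
      using norm_iexp_minus_quadratic[of "a * x"] by simp
    also have "\<dots> \<le> (a * x)\<^sup>2 * min 1 \<bar>x\<bar>"
      using a mult_right_mono[OF a, of "\<bar>x\<bar>"] by (intro mult_left_mono min.mono) (auto simp: abs_mult)
    finally show ?thesis by (simp add: B_def power_mult_distrib mult_ac)
  qed
  have "bern_cf q x - of_real (1 - V * x\<^sup>2 / 2)
      = of_real q * (iexp ((1 - q) * x) - (1 + \<i> * ((1 - q) * x) - ((1 - q) * x)\<^sup>2 / 2))
      + of_real (1 - q) * (iexp ((- q) * x) - (1 + \<i> * ((- q) * x) - ((- q) * x)\<^sup>2 / 2))"
    by (simp add: bern_cf_def V_def power2_eq_square field_simps)
  also have "norm \<dots> \<le> q * ((1 - q)\<^sup>2 * B) + (1 - q) * ((- q)\<^sup>2 * B)"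
    using scaled[of "1 - q"] scaled[of "- q"] q
    by (intro order_trans[OF norm_triangle_ineq] add_mono)
       (simp_all add: norm_mult mult_left_mono del: of_real_diff)
  also have "\<dots> = V * B"
    by (simp add: V_def power2_eq_square algebra_simps)
  finally have 1: "norm (bern_cf q x - of_real (1 - V * x\<^sup>2 / 2)) \<le> V * B" .
  have "\<bar>exp (- (V * x\<^sup>2 / 2)) - (1 - V * x\<^sup>2 / 2)\<bar> \<le> min (V * x\<^sup>2 / 2) ((V * x\<^sup>2 / 2)\<^sup>2)"
    using V by (intro exp_minus_linear_bound) auto
  also have "\<dots> \<le> V * B"
  proof (cases "\<bar>x\<bar> \<le> 1")
    case True
    have "(V * x\<^sup>2 / 2)\<^sup>2 = V * (V * x\<^sup>2 * \<bar>x\<bar> * \<bar>x\<bar> / 4)"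
      by (simp add: power2_eq_square)
    also have "\<dots> \<le> V * (1 * x\<^sup>2 * \<bar>x\<bar> * 1 / 1)"
      using V True by (intro mult_left_mono frac_le mult_mono) auto
    finally show ?thesis using True by (simp add: B_def min_def)
  next
    case False
    then have "B = x\<^sup>2" by (simp add: B_def)
    then show ?thesis using V by (intro order_trans[OF min.cobounded1]) simp
  qed
  finally have 2: "norm (of_real (1 - V * x\<^sup>2 / 2) - complex_of_real (exp (- (V * x\<^sup>2 / 2)))) \<le> V * B"
    by (metis abs_minus_commute norm_of_real of_real_diff)
  have "norm (bern_cf q x - of_real (exp (- (V * x\<^sup>2 / 2)))) \<le> V * B + V * B"
    using norm_triangle_mono[OF 1 2] by simp
  then show ?thesis
    unfolding V_def[symmetric] B_def[symmetric] by (simp add: mult_ac)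
qed

section \<open>Fourier inversion for the sample sum\<close>

lemma lborel_integral_iexp_of_int:
  "(LINT s|lborel. indicator {c - pi..c + pi} s *\<^sub>R iexp (of_int j * s))
     = (if j = 0 then complex_of_real (2 * pi) else 0)"
proof (cases "j = 0")
  case True
  have "(LINT s|lborel. indicator {c - pi..c + pi} s *\<^sub>R (1::complex))
      = complex_of_real (c + pi) - complex_of_real (c - pi)"
    by (rule integral_FTC_Icc)
       (auto intro!: derivative_eq_intros has_vector_derivative_of_real)
  with True show ?thesis by simp
next
  case False
  let ?F = "\<lambda>s. iexp (of_int j * s) / (\<i> * of_int j)"
  have "(LINT s|lborel. indicator {c - pi..c + pi} s *\<^sub>R iexp (of_int j * s))
      = ?F (c + pi) - ?F (c - pi)"
  proof (rule integral_FTC_Icc)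
    fix s
    have "((\<lambda>z. exp (\<i> * (of_int j * z)) / (\<i> * of_int j)) has_field_derivative
            exp (\<i> * (of_int j * of_real s))) (at (of_real s))"
      using False by (auto intro!: derivative_eq_intros simp: field_simps)
    then have "(?F has_vector_derivative iexp (of_int j * s)) (at s)"
      using has_vector_derivative_real_field by fastforce
    then show "(?F has_vector_derivative iexp (of_int j * s)) (at s within {c - pi..c + pi})"
      by (rule has_vector_derivative_at_within)
  qed (auto intro!: continuous_intros)
  also have "iexp (of_int j * (c + pi)) = exp (\<i> * of_real (of_int j * (c - pi)) + \<i> * of_int (2 * j) * pi)"
    by (rule arg_cong[where f = exp]) (simp add: algebra_simps)
  also have "\<dots> = iexp (of_int j * (c - pi)) * exp (\<i> * of_int (2 * j) * pi)"
    by (rule exp_add)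
  also have "exp (\<i> * of_int (2 * j) * pi) = 1"
    by (simp add: exp_eq_1)
  finally show ?thesis using False by simp
qed

text \<open>Up to the factor \<open>n choose m\<close>, the characteristic function of the centred sample sum.\<close>
definition subset_cf :: "nat \<Rightarrow> nat \<Rightarrow> (nat \<Rightarrow> int) \<Rightarrow> real \<Rightarrow> complex" where
  "subset_cf m n d t = (\<Sum>A | A \<subseteq> {1..n} \<and> card A = m. iexp (t * (\<Sum>i\<in>A. deviation n d i)))"

lemma subset_cf_0: "subset_cf m n d 0 = of_nat (n choose m)"
  by (simp add: subset_cf_def n_subsets)

lemma continuous_on_subset_cf: "continuous_on S (subset_cf m n d)"
  unfolding subset_cf_def by (intro continuous_intros)

text \<open>The joint characteristic function at \<open>(s, t)\<close> of the centred number of successes and the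
  centred sum over the successes, for independent tosses with success probability \<open>q\<close>.\<close>
definition bern_prod :: "real \<Rightarrow> nat \<Rightarrow> (nat \<Rightarrow> int) \<Rightarrow> real \<Rightarrow> real \<Rightarrow> complex" where
  "bern_prod q n d s t = (\<Prod>i=1..n. bern_cf q (s + t * deviation n d i))"

lemma prod_bern_cf:
  assumes "finite I"
  shows "(\<Prod>i\<in>I. bern_cf q (x i)) =
    (\<Sum>A\<in>Pow I. of_real (q ^ card A * (1 - q) ^ (card I - card A)) * iexp ((\<Sum>i\<in>A. x i) - q * (\<Sum>i\<in>I. x i)))"
proof -
  have "(\<Prod>i\<in>I. bern_cf q (x i)) = (\<Sum>A\<in>Pow I.
      (\<Prod>i\<in>A. of_real q * iexp ((1 - q) * x i)) * (\<Prod>i\<in>I - A. of_real (1 - q) * iexp (- (q * x i))))"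
    unfolding bern_cf_def by (rule prod_add[OF assms])
  also have "\<dots> = (\<Sum>A\<in>Pow I. of_real (q ^ card A * (1 - q) ^ (card I - card A)) *
      iexp ((\<Sum>i\<in>A. x i) - q * (\<Sum>i\<in>I. x i)))"
  proof (intro sum.cong refl)
    fix A assume "A \<in> Pow I"
    then have A: "A \<subseteq> I" "finite A" using assms finite_subset by auto
    have "(\<Sum>i\<in>A. x i) - q * (\<Sum>i\<in>I. x i) = (\<Sum>i\<in>A. (1 - q) * x i) + (\<Sum>i\<in>I - A. - (q * x i))"
      using sum.subset_diff[OF A(1) assms, of x]
      by (simp only: sum_negf sum_distrib_left[symmetric]) (simp add: algebra_simps)
    then have "iexp ((\<Sum>i\<in>A. x i) - q * (\<Sum>i\<in>I. x i))
        = (\<Prod>i\<in>A. iexp ((1 - q) * x i)) * (\<Prod>i\<in>I - A. iexp (- (q * x i)))"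
      using A assms by (simp add: ring_distribs exp_add exp_sum[symmetric] sum_distrib_left)
    then show "(\<Prod>i\<in>A. of_real q * iexp ((1 - q) * x i)) * (\<Prod>i\<in>I - A. of_real (1 - q) * iexp (- (q * x i)))
        = of_real (q ^ card A * (1 - q) ^ (card I - card A)) * iexp ((\<Sum>i\<in>A. x i) - q * (\<Sum>i\<in>I. x i))"
      using A assms by (simp add: prod.distrib card_Diff_subset mult_ac)
  qed
  finally show ?thesis .
qed

lemma bern_prod_eq:
  assumes "m \<le> n" "0 < n"
  defines "q \<equiv> real m / real n"
  shows "bern_prod q n d s t = (\<Sum>A\<in>Pow {1..n}.
    of_real (q ^ card A * (1 - q) ^ (n - card A)) * iexp (t * (\<Sum>i\<in>A. deviation n d i))
      * iexp (of_int (int (card A) - int m) * s))"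
proof -
  have 1: "(\<Sum>i=1..n. s + t * deviation n d i) = n * s"
    using sum_deviation[of n d] by (simp add: sum.distrib sum_distrib_left[symmetric])
  have 2: "q * (n * s) = m * s"
    using assms by simp
  have 3: "iexp ((\<Sum>i\<in>A. s + t * deviation n d i) - m * s)
      = iexp (t * (\<Sum>i\<in>A. deviation n d i)) * iexp (of_int (int (card A) - int m) * s)" for A
    by (simp add: exp_add[symmetric] sum.distrib sum_distrib_left[symmetric] algebra_simps)
  show ?thesis
    unfolding bern_prod_def prod_bern_cf[OF finite_atLeastAtMost] 1 2 3
    by (simp only: card_atLeastAtMost diff_Suc_1 mult.assoc)
qed

lemma lborel_integrable_indicator_iexp:
  "integrable lborel (\<lambda>s. indicator {a..b} s *\<^sub>R iexp (c * s))"
  by (rule borel_integrable_compact) (auto intro!: continuous_intros)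

text \<open>Integration over a period in \<open>s\<close> picks out the subsets of size exactly \<open>m\<close>. The period is
  allowed any centre \<open>c\<close>: centring the data shifts the frequency \<open>s\<close> by \<open>t\<close> times the mean, and
  this shift is undone later by the choice of \<open>c\<close>.\<close>
lemma lborel_integral_bern_prod:
  assumes "m \<le> n" "0 < n"
  defines "q \<equiv> real m / real n"
  shows "(LINT s|lborel. indicator {c - pi..c + pi} s *\<^sub>R bern_prod q n d s t)
    = 2 * pi * (q ^ m * (1 - q) ^ (n - m)) * subset_cf m n d t"
proof -
  define w where "w A = of_real (q ^ card A * (1 - q) ^ (n - card A)) * iexp (t * (\<Sum>i\<in>A. deviation n d i))" for A
  have "(LINT s|lborel. indicator {c - pi..c + pi} s *\<^sub>R bern_prod q n d s t)
      = (LINT s|lborel. (\<Sum>A\<in>Pow {1..n}. w A * (indicator {c - pi..c + pi} s *\<^sub>R iexp (of_int (int (card A) - int m) * s))))"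
    unfolding q_def bern_prod_eq[OF assms(1,2)] by (simp add: w_def q_def scaleR_sum_right mult_ac)
  also have "\<dots> = (\<Sum>A\<in>Pow {1..n}. w A * (LINT s|lborel. indicator {c - pi..c + pi} s *\<^sub>R iexp (of_int (int (card A) - int m) * s)))"
    by (subst Bochner_Integration.integral_sum)
       (simp_all only: integrable_mult_right lborel_integrable_indicator_iexp integral_mult_right_zero)
  also have "\<dots> = (\<Sum>A\<in>Pow {1..n}. if card A = m then w A * (2 * pi) else 0)"
    unfolding lborel_integral_iexp_of_int by (intro sum.cong) auto
  also have "\<dots> = (\<Sum>A | A \<subseteq> {1..n} \<and> card A = m. w A * (2 * pi))"
    by (subst sum.inter_filter[symmetric]) (simp_all add: Pow_def)
  also have "\<dots> = 2 * pi * (q ^ m * (1 - q) ^ (n - m)) * subset_cf m n d t"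
    unfolding subset_cf_def by (subst sum_distrib_left) (auto simp: w_def intro!: sum.cong)
  finally show ?thesis .
qed

lemma lborel_integral_subset_cf:
  "(LINT t|lborel. indicator {- pi..pi} t *\<^sub>R (subset_cf m n d t * iexp (- (t * (of_int k - real m * seq_mean n d)))))
    = 2 * pi * card {A. A \<subseteq> {1..n} \<and> card A = m \<and> (\<Sum>i\<in>A. d i) = k}"
proof -
  let ?F = "{A. A \<subseteq> {1..n} \<and> card A = m}"
  have fin: "finite ?F" by (rule finite_subset[of _ "Pow {1..n}"]) auto
  have dev: "(\<Sum>i\<in>A. deviation n d i) = of_int (\<Sum>i\<in>A. d i) - m * seq_mean n d" if "A \<in> ?F" for A
    using that by (simp add: deviation_def sum_subtractf)
  have "subset_cf m n d t * iexp (- (t * (of_int k - real m * seq_mean n d)))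
      = (\<Sum>A\<in>?F. iexp (of_int ((\<Sum>i\<in>A. d i) - k) * t))" for t
    unfolding subset_cf_def sum_distrib_right
  proof (intro sum.cong refl)
    fix A assume "A \<in> ?F"
    note dev[OF this]
    then show "iexp (t * (\<Sum>i\<in>A. deviation n d i)) * iexp (- (t * (of_int k - real m * seq_mean n d)))
        = iexp (of_int ((\<Sum>i\<in>A. d i) - k) * t)"
      by (simp only: exp_add[symmetric]) (simp add: algebra_simps)
  qed
  then have "(LINT t|lborel. indicator {- pi..pi} t *\<^sub>R (subset_cf m n d t * iexp (- (t * (of_int k - real m * seq_mean n d)))))
      = (LINT t|lborel. (\<Sum>A\<in>?F. indicator {0 - pi..0 + pi} t *\<^sub>R iexp (of_int ((\<Sum>i\<in>A. d i) - k) * t)))"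
    by (simp add: scaleR_sum_right)
  also have "\<dots> = (\<Sum>A\<in>?F. (LINT t|lborel. indicator {0 - pi..0 + pi} t *\<^sub>R iexp (of_int ((\<Sum>i\<in>A. d i) - k) * t)))"
    by (rule Bochner_Integration.integral_sum) (rule lborel_integrable_indicator_iexp)
  also have "\<dots> = (\<Sum>A\<in>?F. if (\<Sum>i\<in>A. d i) = k then 2 * pi else 0)"
    unfolding lborel_integral_iexp_of_int by (simp add: if_distrib[of complex_of_real] of_real_sum[symmetric] cong: if_cong)
  also have "\<dots> = 2 * pi * card {A. A \<subseteq> {1..n} \<and> card A = m \<and> (\<Sum>i\<in>A. d i) = k}"
    using fin by (simp add: sum.inter_filter[symmetric] conj_assoc mult.commute)
  finally show ?thesis .
qed

section \<open>Gaussian approximation of the Bernoulli product\<close>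

lemma norm_bern_prod_le:
  "norm (bern_prod q n d s t) \<le> exp (- (q * (1 - q) * (\<Sum>i=1..n. 1 - cos (s + t * deviation n d i))))"
proof -
  have "norm (bern_prod q n d s t) = (\<Prod>i=1..n. norm (bern_cf q (s + t * deviation n d i)))"
    by (simp add: bern_prod_def prod_norm)
  also have "\<dots> \<le> (\<Prod>i=1..n. exp (- (q * (1 - q) * (1 - cos (s + t * deviation n d i)))))"
    by (intro prod_mono) (simp add: norm_bern_cf_le)
  also have "\<dots> = exp (- (q * (1 - q) * (\<Sum>i=1..n. 1 - cos (s + t * deviation n d i))))"
    by (simp only: exp_sum[symmetric] finite_atLeastAtMost sum_negf sum_distrib_left)
  finally show ?thesis .
qed

text \<open>The quantity that Lindeberg's condition requires to vanish.\<close>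
definition lindeberg_tail :: "nat \<Rightarrow> nat \<Rightarrow> (nat \<Rightarrow> int) \<Rightarrow> real \<Rightarrow> real" where
  "lindeberg_tail m n d \<epsilon> = 1 / seq_Q n d *
     (\<Sum>i | i \<in> {1..n} \<and> \<bar>deviation n d i\<bar> > \<epsilon> * sigma_hat m n d. (deviation n d i)\<^sup>2)"

text \<open>A telescoping comparison of two products with factors in the unit disc. An argument
  \<open>x\<^sub>i = w / v + u a\<^sub>i / \<sigma>\<close> with \<open>\<bar>x\<^sub>i\<bar> > \<delta>\<close> must have a large deviation \<open>a\<^sub>i\<close>, as the first summand is
  at most \<open>\<delta> / 2\<close>, and then the second summand dominates. So the small arguments contribute at most
  \<open>\<delta>\<close> times the total variance and the large ones are paid for by the Lindeberg sum.\<close>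
lemma norm_bern_prod_minus_gauss:
  fixes q v w u \<delta> \<epsilon> :: real and m n :: nat
  defines "q \<equiv> real m / real n"
  defines "v \<equiv> sqrt (n * (q * (1 - q)))"
  assumes q: "0 < q" "q < 1" and Q: "seq_Q n d > 0"
    and \<delta>: "\<bar>w\<bar> / v \<le> \<delta> / 2" "\<bar>u\<bar> * \<epsilon> \<le> \<delta> / 2"
  shows "norm (bern_prod q n d (w / v) (u / sigma_hat m n d) - of_real (exp (- (w\<^sup>2 + u\<^sup>2) / 2)))
    \<le> 2 * \<delta> * (w\<^sup>2 + u\<^sup>2) + 8 * u\<^sup>2 * lindeberg_tail m n d \<epsilon>"
proof -
  define a where "a = deviation n d"
  define \<sigma> where "\<sigma> = sigma_hat m n d"
  define x where "x i = w / v + u / \<sigma> * a i" for i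
  define V where "V = q * (1 - q)"
  let ?large = "\<lambda>i. \<bar>a i\<bar> > \<epsilon> * \<sigma>"
  have V: "V > 0" using q by (simp add: V_def)
  have n: "n > 0" using q by (cases n) (auto simp: q_def)
  have v: "v > 0" "v\<^sup>2 = n * V"
    using n V by (simp_all add: v_def V_def[symmetric])
  have \<sigma>: "\<sigma> > 0" "\<sigma>\<^sup>2 = V * seq_Q n d"
    using V Q by (simp_all add: \<sigma>_def sigma_hat_def sigma_hat_sq_def q_def[symmetric] V_def[symmetric])
  have "0 \<le> \<bar>w\<bar> / v" using v by simp
  then have "\<delta> \<ge> 0" using \<delta>(1) by linarith
  have "V * (\<Sum>i=1..n. (x i)\<^sup>2) = V * n * (w / v)\<^sup>2 + V * seq_Q n d * (u / \<sigma>)\<^sup>2"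
    unfolding x_def a_def sum_sq_affine_deviation by (simp add: algebra_simps)
  also have "\<dots> = w\<^sup>2 + u\<^sup>2"
    using v \<sigma> V n Q by (simp add: power_divide)
  finally have sq: "V * (\<Sum>i=1..n. (x i)\<^sup>2) = w\<^sup>2 + u\<^sup>2" .
  have gauss: "exp (- (w\<^sup>2 + u\<^sup>2) / 2) = (\<Prod>i=1..n. exp (- (V * (x i)\<^sup>2 / 2)))"
    unfolding exp_sum[OF finite_atLeastAtMost, symmetric] sum_negf sum_divide_distrib[symmetric]
      sum_distrib_left[symmetric] sq by (simp add: field_simps)
  have bound: "(x i)\<^sup>2 * min 1 \<bar>x i\<bar> \<le> \<delta> * (x i)\<^sup>2 + (if ?large i then 4 * u\<^sup>2 / \<sigma>\<^sup>2 * (a i)\<^sup>2 else 0)" for i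
  proof (cases "\<bar>x i\<bar> \<le> \<delta>")
    case True
    have "(x i)\<^sup>2 * min 1 \<bar>x i\<bar> \<le> (x i)\<^sup>2 * \<delta>"
      using True by (intro mult_left_mono) auto
    moreover have "(if ?large i then 4 * u\<^sup>2 / \<sigma>\<^sup>2 * (a i)\<^sup>2 else 0) \<ge> 0" by simp
    ultimately show ?thesis by (simp add: mult.commute)
  next
    case False
    have "\<bar>x i\<bar> \<le> \<bar>w\<bar> / v + \<bar>u\<bar> / \<sigma> * \<bar>a i\<bar>"
      unfolding x_def using v \<sigma> by (intro order_trans[OF abs_triangle_ineq]) (simp add: abs_mult)
    with False \<delta>(1) have *: "\<bar>u\<bar> / \<sigma> * \<bar>a i\<bar> > \<delta> / 2" "\<bar>x i\<bar> \<le> 2 * (\<bar>u\<bar> / \<sigma> * \<bar>a i\<bar>)"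
      by linarith+
    have "\<bar>u\<bar> * \<epsilon> < \<bar>u\<bar> / \<sigma> * \<bar>a i\<bar>" using *(1) \<delta>(2) by linarith
    then have "\<bar>u\<bar> * (\<epsilon> * \<sigma>) < \<bar>u\<bar> * \<bar>a i\<bar>"
      using \<sigma> by (simp add: field_simps)
    then have large: "?large i"
      by (rule mult_left_less_imp_less) simp
    have "(x i)\<^sup>2 * min 1 \<bar>x i\<bar> \<le> (x i)\<^sup>2 * 1"
      by (intro mult_left_mono) auto
    also have "\<dots> \<le> (2 * (\<bar>u\<bar> / \<sigma> * \<bar>a i\<bar>))\<^sup>2"
      using power_mono[OF *(2), of 2] by simp
    also have "\<dots> = 4 * u\<^sup>2 / \<sigma>\<^sup>2 * (a i)\<^sup>2"
      by (simp add: power_mult_distrib power_divide)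
    finally show ?thesis using large \<open>\<delta> \<ge> 0\<close> by (simp add: add_increasing)
  qed
  have coef: "2 * V * (4 * u\<^sup>2 / \<sigma>\<^sup>2) = 8 * u\<^sup>2 * (1 / seq_Q n d)"
    unfolding \<sigma>(2) using V Q by (simp add: field_simps)
  have "norm (bern_prod q n d (w / v) (u / \<sigma>) - of_real (exp (- (w\<^sup>2 + u\<^sup>2) / 2)))
      = norm ((\<Prod>i=1..n. bern_cf q (x i)) - (\<Prod>i=1..n. of_real (exp (- (V * (x i)\<^sup>2 / 2)))))"
    unfolding gauss of_real_prod by (simp add: bern_prod_def x_def a_def)
  also have "\<dots> \<le> (\<Sum>i=1..n. norm (bern_cf q (x i) - of_real (exp (- (V * (x i)\<^sup>2 / 2)))))"
    using q V by (intro norm_prod_diff norm_bern_cf_le_1) auto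
  also have "\<dots> \<le> (\<Sum>i=1..n. 2 * V * ((x i)\<^sup>2 * min 1 \<bar>x i\<bar>))"
    using q by (intro sum_mono) (simp only: V_def norm_bern_cf_minus_gauss less_imp_le)
  also have "\<dots> \<le> (\<Sum>i=1..n. 2 * V * (\<delta> * (x i)\<^sup>2 + (if ?large i then 4 * u\<^sup>2 / \<sigma>\<^sup>2 * (a i)\<^sup>2 else 0)))"
    using V by (intro sum_mono mult_left_mono bound) auto
  also have "\<dots> = 2 * \<delta> * (V * (\<Sum>i=1..n. (x i)\<^sup>2)) + 2 * V * (4 * u\<^sup>2 / \<sigma>\<^sup>2) * (\<Sum>i=1..n. if ?large i then (a i)\<^sup>2 else 0)"
    unfolding sum_distrib_left sum.distrib[symmetric] by (intro sum.cong) (auto simp: algebra_simps)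
  also have "(\<Sum>i=1..n. if ?large i then (a i)\<^sup>2 else 0) = (\<Sum>i | i \<in> {1..n} \<and> ?large i. (a i)\<^sup>2)"
    by (rule sum.inter_filter[symmetric]) simp
  also have "2 * V * (4 * u\<^sup>2 / \<sigma>\<^sup>2) * \<dots> = 8 * u\<^sup>2 * lindeberg_tail m n d \<epsilon>"
    unfolding coef by (simp add: lindeberg_tail_def a_def \<sigma>_def)
  finally show ?thesis unfolding sq \<sigma>_def .
qed

text \<open>Deviations below the Lindeberg threshold contribute at most \<open>n \<epsilon>\<^sup>2 \<sigma>\<^sup>2\<close> to \<open>Q\<close>. When the tail is
  small and \<open>Q\<close> is of order \<open>n\<close>, this forces \<open>\<sigma>\<close> to be at least of order \<open>1 / \<epsilon>\<close>.\<close>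
lemma seq_Q_le_tail:
  assumes "0 \<le> \<epsilon> * sigma_hat m n d" "seq_Q n d > 0"
  shows "seq_Q n d \<le> seq_Q n d * lindeberg_tail m n d \<epsilon> + n * (\<epsilon> * sigma_hat m n d)\<^sup>2"
proof -
  let ?a = "deviation n d" and ?b = "\<epsilon> * sigma_hat m n d"
  have "seq_Q n d \<le> (\<Sum>i=1..n. (if \<bar>?a i\<bar> > ?b then (?a i)\<^sup>2 else 0) + ?b\<^sup>2)"
    unfolding seq_Q_eq using assms(1) power_mono[of "\<bar>?a _\<bar>" ?b 2] by (intro sum_mono) auto
  also have "\<dots> = (\<Sum>i=1..n. if \<bar>?a i\<bar> > ?b then (?a i)\<^sup>2 else 0) + n * ?b\<^sup>2"
    by (simp add: sum.distrib)
  also have "(\<Sum>i=1..n. if \<bar>?a i\<bar> > ?b then (?a i)\<^sup>2 else 0) = (\<Sum>i | i \<in> {1..n} \<and> \<bar>?a i\<bar> > ?b. (?a i)\<^sup>2)"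
    by (rule sum.inter_filter[symmetric]) simp
  also have "\<dots> = seq_Q n d * lindeberg_tail m n d \<epsilon>"
    using assms(2) by (simp add: lindeberg_tail_def)
  finally show ?thesis .
qed

section \<open>Nonlattice distributions\<close>

text \<open>The function \<open>\<bar>sin (x / 2)\<bar>\<close> is subadditive and vanishes exactly on the multiples of \<open>2\<pi>\<close>, so it
  measures the distance to \<open>2\<pi>\<int>\<close> like a norm; its square is \<open>(1 - cos x) / 2\<close>. This turns the
  required lower bound for sums of \<open>1 - cos\<close> into triangle inequalities.\<close>
lemma two_sin_sq_half: "2 * \<bar>sin (x / 2)\<bar>\<^sup>2 = 1 - cos x" for x :: real
  using cos_double_sin[of "x/2"] by simp

lemma abs_sin_half_add: "\<bar>sin ((x + y) / 2)\<bar> \<le> \<bar>sin (x / 2)\<bar> + \<bar>sin (y / 2)\<bar>" for x y :: real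
proof -
  have "\<bar>sin ((x + y) / 2)\<bar> \<le> \<bar>sin (x/2)\<bar> * \<bar>cos (y/2)\<bar> + \<bar>cos (x/2)\<bar> * \<bar>sin (y/2)\<bar>"
    unfolding add_divide_distrib sin_add abs_mult[symmetric] by (rule abs_triangle_ineq)
  also have "\<dots> \<le> \<bar>sin (x/2)\<bar> * 1 + 1 * \<bar>sin (y/2)\<bar>"
    by (intro add_mono mult_mono) auto
  finally show ?thesis by simp
qed

lemma abs_sin_half_diff: "\<bar>sin ((x - y) / 2)\<bar> \<le> \<bar>sin (x / 2)\<bar> + \<bar>sin (y / 2)\<bar>" for x y :: real
  using abs_sin_half_add[of x "-y"] by simp

lemma abs_sin_half_mult_int: "\<bar>sin (real_of_int k * x / 2)\<bar> \<le> \<bar>real_of_int k\<bar> * \<bar>sin (x / 2)\<bar>" for x :: real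
proof -
  have nat: "\<bar>sin (of_nat j * x / 2)\<bar> \<le> of_nat j * \<bar>sin (x / 2)\<bar>" for j
  proof (induction j)
    case (Suc j)
    show ?case
      using abs_sin_half_add[of "of_nat j * x" x] Suc by (simp add: algebra_simps)
  qed simp
  show ?thesis
  proof (cases "k \<ge> 0")
    case True
    with nat[of "nat k"] show ?thesis by simp
  next
    case False
    then have "\<bar>real_of_int k\<bar> = - real_of_int k" by simp
    with nat[of "nat (- k)"] False show ?thesis by simp
  qed
qed

text \<open>Concavity of the sine on \<open>[0, \<pi>]\<close>.\<close>
lemma abs_sin_half_ge:
  fixes x :: real
  assumes "\<bar>x\<bar> \<le> pi"
  shows "\<bar>x\<bar> / pi \<le> \<bar>sin (x / 2)\<bar>"
proof -
  have *: "y / pi \<le> sin (y / 2)" if y: "0 \<le> y" "y \<le> pi" for y :: real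
  proof -
    have conv: "convex_on {0..pi} (\<lambda>z. - sin z)"
    proof (rule f''_ge0_imp_convex)
      show "((\<lambda>z. - sin z) has_real_derivative - cos z) (at z)" for z :: real
        by (auto intro!: derivative_eq_intros)
      show "((\<lambda>z. - cos z) has_real_derivative sin z) (at z)" for z :: real
        by (auto intro!: derivative_eq_intros)
    qed (auto intro: sin_ge_zero)
    have "- sin ((1 - y / pi) *\<^sub>R 0 + (y / pi) *\<^sub>R (pi / 2)) \<le> (1 - y / pi) * - sin 0 + (y / pi) * - sin (pi / 2)"
      by (rule convex_onD[OF conv]) (use y in \<open>auto simp: divide_simps\<close>)
    then show ?thesis by simp
  qed
  show ?thesis
    using *[of "\<bar>x\<bar>"] assms by (cases "x \<ge> 0") (auto simp: abs_if)
qed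

text \<open>The integers \<open>j\<close> for which \<open>\<bar>sin (t j / 2)\<bar>\<close> is bounded, uniformly in \<open>s\<close> and \<open>t\<close>, by a multiple of
  such a finite sum form a subgroup of \<open>\<int>\<close>. It contains all differences of elements of \<open>A\<close>, hence
  their greatest common divisor \<open>1\<close>.\<close>
lemma abs_sin_half_le_atoms:
  fixes A :: "int set"
  assumes "Gcd {i - j | i j. i \<in> A \<and> j \<in> A} = 1"
  obtains K C where "finite K" "K \<subseteq> A" "C \<ge> 0"
    "\<And>s t. \<bar>sin (t / 2)\<bar> \<le> C * (\<Sum>k\<in>K. \<bar>sin ((s + t * real_of_int k) / 2)\<bar>)"
proof -
  let ?N = "\<lambda>s t k. \<bar>sin ((s + t * real_of_int k) / 2)\<bar>"
  let ?P = "\<lambda>j. \<exists>K (C::real). finite K \<and> K \<subseteq> A \<and> C \<ge> 0 \<and>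
    (\<forall>s t. \<bar>sin (t * real_of_int j / 2)\<bar> \<le> C * (\<Sum>k\<in>K. ?N s t k))"
  have "1 \<in> group_closure {i - j | i j. i \<in> A \<and> j \<in> A}"
    using Gcd_in_group_closure[of "{i - j | i j. i \<in> A \<and> j \<in> A}"] assms by simp
  then have "?P 1"
  proof induction
    case (base j)
    then consider "j = 0" | k l where "j = k - l" "k \<in> A" "l \<in> A" by auto
    then show ?case
    proof cases
      case 1
      then show ?thesis by (intro exI[of _ "{}"] exI[of _ 0]) auto
    next
      case 2
      have "\<bar>sin (t * real_of_int j / 2)\<bar> \<le> 2 * (\<Sum>k\<in>{k, l}. ?N s t k)" for s t
      proof -
        have "\<bar>sin (t * real_of_int j / 2)\<bar> \<le> ?N s t k + ?N s t l"
          using abs_sin_half_diff[of "s + t * real_of_int k" "s + t * real_of_int l"] 2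
          by (simp add: right_diff_distrib)
        also have "\<dots> \<le> 2 * (\<Sum>k\<in>{k, l}. ?N s t k)"
          by (cases "k = l") auto
        finally show ?thesis .
      qed
      then show ?thesis
        using 2 by (intro exI[of _ "{k, l}"] exI[of _ 2]) auto
    qed
  next
    case (diff i j)
    then obtain K C L D where
      K: "finite K" "K \<subseteq> A" "C \<ge> 0" "\<And>s t. \<bar>sin (t * real_of_int i / 2)\<bar> \<le> C * (\<Sum>k\<in>K. ?N s t k)" and
      L: "finite L" "L \<subseteq> A" "D \<ge> 0" "\<And>s t. \<bar>sin (t * real_of_int j / 2)\<bar> \<le> D * (\<Sum>k\<in>L. ?N s t k)"
      by blast
    have "\<bar>sin (t * real_of_int (i - j) / 2)\<bar> \<le> (C + D) * (\<Sum>k\<in>K \<union> L. ?N s t k)" for s t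
    proof -
      have "\<bar>sin (t * real_of_int (i - j) / 2)\<bar> \<le> C * (\<Sum>k\<in>K. ?N s t k) + D * (\<Sum>k\<in>L. ?N s t k)"
        using abs_sin_half_diff[of "t * real_of_int i" "t * real_of_int j"] K(4)[of t s] L(4)[of t s]
        by (simp add: algebra_simps)
      also have "\<dots> \<le> C * (\<Sum>k\<in>K \<union> L. ?N s t k) + D * (\<Sum>k\<in>K \<union> L. ?N s t k)"
        using K L by (intro add_mono mult_left_mono sum_mono2) auto
      finally show ?thesis by (simp add: algebra_simps)
    qed
    then show ?case
      using K(1-3) L(1-3) by (intro exI[of _ "K \<union> L"] exI[of _ "C + D"]) auto
  qed
  then show thesis using that by auto
qed

text \<open>The preceding lemma bounds \<open>t\<close>, and any single \<open>a \<in> A\<close> then recovers \<open>s\<close> from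
  \<open>s + t a\<close>; Cauchy-Schwarz passes from \<open>\<bar>sin\<bar>\<close> to its square.\<close>
lemma sum_one_minus_cos_ge:
  fixes A :: "int set"
  assumes "Gcd {i - j | i j. i \<in> A \<and> j \<in> A} = 1"
  obtains K c where "finite K" "K \<subseteq> A" "c > 0"
    "\<And>s t. \<bar>s\<bar> \<le> pi \<Longrightarrow> \<bar>t\<bar> \<le> pi \<Longrightarrow> c * (s\<^sup>2 + t\<^sup>2) \<le> (\<Sum>k\<in>K. 1 - cos (s + t * real_of_int k))"
proof -
  obtain K0 C where K0: "finite K0" "K0 \<subseteq> A" "C \<ge> 0"
    "\<And>s t. \<bar>sin (t / 2)\<bar> \<le> C * (\<Sum>k\<in>K0. \<bar>sin ((s + t * real_of_int k) / 2)\<bar>)"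
    using abs_sin_half_le_atoms[OF assms] by blast
  have "A \<noteq> {}" using assms by auto
  then obtain a where "a \<in> A" by auto
  define K where "K = insert a K0"
  let ?N = "\<lambda>s t k. \<bar>sin ((s + t * real_of_int k) / 2)\<bar>"
  have K: "finite K" "K \<subseteq> A" "card K > 0"
    using K0 \<open>a \<in> A\<close> by (auto simp: K_def card_gt_0_iff)
  define D where "D = pi * (1 + C * (1 + \<bar>real_of_int a\<bar>))"
  have "1 + C * (1 + \<bar>real_of_int a\<bar>) > 0"
    using K0(3) by (intro add_pos_nonneg mult_nonneg_nonneg) auto
  then have D: "D > 0" by (simp add: D_def)
  have le: "\<bar>s\<bar> + \<bar>t\<bar> \<le> D * (\<Sum>k\<in>K. ?N s t k)" if st: "\<bar>s\<bar> \<le> pi" "\<bar>t\<bar> \<le> pi" for s t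
  proof -
    define \<Sigma> where "\<Sigma> = (\<Sum>k\<in>K. ?N s t k)"
    have t: "\<bar>sin (t / 2)\<bar> \<le> C * \<Sigma>"
      unfolding \<Sigma>_def K_def
      by (rule order_trans[OF K0(4)[of t s]]) (use K0 in \<open>intro mult_left_mono sum_mono2; auto\<close>)
    have "\<bar>sin (s / 2)\<bar> \<le> ?N s t a + \<bar>real_of_int a\<bar> * \<bar>sin (t / 2)\<bar>"
      using abs_sin_half_diff[of "s + t * real_of_int a" "real_of_int a * t"] abs_sin_half_mult_int[of a t]
      by (simp add: algebra_simps)
    also have "\<dots> \<le> \<Sigma> + \<bar>real_of_int a\<bar> * (C * \<Sigma>)"
      using t K unfolding \<Sigma>_def K_def by (intro add_mono mult_left_mono member_le_sum) auto
    finally have s: "\<bar>sin (s / 2)\<bar> \<le> \<Sigma> + \<bar>real_of_int a\<bar> * (C * \<Sigma>)" .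
    have "(\<bar>s\<bar> + \<bar>t\<bar>) / pi \<le> (1 + C * (1 + \<bar>real_of_int a\<bar>)) * \<Sigma>"
      using abs_sin_half_ge[OF st(1)] abs_sin_half_ge[OF st(2)] s t
      by (simp add: algebra_simps add_divide_distrib)
    then show ?thesis
      unfolding D_def \<Sigma>_def[symmetric] by (simp add: pos_divide_le_eq mult_ac)
  qed
  define c where "c = 2 / (D\<^sup>2 * card K)"
  have "c > 0" using D K by (simp add: c_def)
  have "c * (s\<^sup>2 + t\<^sup>2) \<le> (\<Sum>k\<in>K. 1 - cos (s + t * real_of_int k))"
    if st: "\<bar>s\<bar> \<le> pi" "\<bar>t\<bar> \<le> pi" for s t
  proof -
    have "s\<^sup>2 + t\<^sup>2 \<le> (\<bar>s\<bar> + \<bar>t\<bar>)\<^sup>2"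
      by (simp add: power2_sum)
    also have "\<dots> \<le> (D * (\<Sum>k\<in>K. ?N s t k))\<^sup>2"
      using le[OF st] by (intro power_mono) auto
    also have "\<dots> \<le> D\<^sup>2 * (card K * (\<Sum>k\<in>K. (?N s t k)\<^sup>2))"
      unfolding power_mult_distrib
      using sum_squared_le_sum_of_squares[of "?N s t" K]
      by (intro mult_left_mono) (simp_all add: mult.commute)
    finally have "2 * (s\<^sup>2 + t\<^sup>2) \<le> D\<^sup>2 * card K * (\<Sum>k\<in>K. 2 * (?N s t k)\<^sup>2)"
      by (simp add: sum_distrib_left[symmetric] mult_ac)
    also have "(\<Sum>k\<in>K. 2 * (?N s t k)\<^sup>2) = (\<Sum>k\<in>K. 1 - cos (s + t * real_of_int k))"
      by (simp only: two_sin_sq_half)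
    finally show ?thesis
      using D K by (simp add: c_def divide_simps mult_ac)
  qed
  then show thesis using that K(1,2) \<open>c > 0\<close> by blast
qed

lemma Gcd_differences_of_nonlattice:
  assumes "nonlattice p"
  shows "Gcd {i - j | i j. i \<in> set_pmf p \<and> j \<in> set_pmf p} = 1"
proof -
  have "enat (nat (Gcd {i - j | i j. pmf p i > 0 \<and> pmf p j > 0})) = 1"
    using assms by (auto simp: nonlattice_def span_pmf_def split: if_splits)
  then have "nat (Gcd {i - j | i j. pmf p i > 0 \<and> pmf p j > 0}) = 1"
    by (simp add: one_enat_def)
  then show ?thesis by (simp add: pmf_positive_iff)
qed

lemma sum_values_ge:
  fixes g :: "int \<Rightarrow> real"
  assumes "finite K" "\<And>k. g k \<ge> 0"
  shows "(\<Sum>k\<in>K. n * rel_freq n d k * g k) \<le> (\<Sum>i=1..n. g (d i))"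
proof -
  have "(\<Sum>k\<in>K. n * rel_freq n d k * g k) = (\<Sum>k\<in>K. \<Sum>i | i \<in> {i \<in> {1..n}. d i \<in> K} \<and> d i = k. g (d i))"
  proof (intro sum.cong refl)
    fix k assume "k \<in> K"
    then have "{i. i \<in> {i \<in> {1..n}. d i \<in> K} \<and> d i = k} = {i \<in> {1..n}. d i = k}" by auto
    moreover have "n * rel_freq n d k = card {i \<in> {1..n}. d i = k}"
      by (cases "n = 0") (simp_all add: rel_freq_def)
    ultimately show "n * rel_freq n d k * g k = (\<Sum>i | i \<in> {i \<in> {1..n}. d i \<in> K} \<and> d i = k. g (d i))"
      by simp
  qed
  also have "\<dots> = (\<Sum>i | i \<in> {1..n} \<and> d i \<in> K. g (d i))"
    by (rule sum.group) (use assms in auto)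
  also have "\<dots> \<le> (\<Sum>i=1..n. g (d i))"
    by (rule sum_mono2) (use assms in auto)
  finally show ?thesis .
qed

section \<open>Gaussian integrals and measurability\<close>

lemma integrable_gauss:
  fixes c :: real
  assumes "c > 0"
  shows "integrable lborel (\<lambda>x. exp (- (c * x\<^sup>2)))"
proof -
  define \<tau> where "\<tau> = sqrt (1 / (2 * c))"
  have \<tau>: "\<tau>\<^sup>2 = 1 / (2 * c)" using assms by (simp add: \<tau>_def)
  have "normal_density 0 \<tau> = (\<lambda>x. (1 / sqrt (2 * pi * \<tau>\<^sup>2)) * exp (- (c * x\<^sup>2)))"
    using assms by (simp add: normal_density_def[abs_def] \<tau> field_simps)
  moreover have "\<tau> > 0" using assms by (simp add: \<tau>_def)
  ultimately have "integrable lborel (\<lambda>x. (1 / sqrt (2 * pi * \<tau>\<^sup>2)) * exp (- (c * x\<^sup>2)))"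
    using integrable_normal_density[of \<tau> 0] by simp
  from integrable_mult_right[OF this, of "sqrt (2 * pi * \<tau>\<^sup>2)"] show ?thesis
    using \<open>\<tau> > 0\<close> by simp
qed

text \<open>The characteristic function of the standard normal distribution, read as a Fourier integral.\<close>
lemma fourier_gauss:
  "(LINT u|lborel. of_real (exp (- u\<^sup>2 / 2)) * iexp (- (u * x))) = complex_of_real (sqrt (2 * pi) * exp (- x\<^sup>2 / 2))"
proof -
  have "complex_of_real (exp (- x\<^sup>2 / 2)) = char std_normal_distribution (- x)"
    by (simp add: char_std_normal_distribution)
  also have "\<dots> = (LINT u|lborel. std_normal_density u *\<^sub>R iexp (- x * u))"
    unfolding char_def by (rule integral_density) auto
  also have "\<dots> = (LINT u|lborel. (1 / sqrt (2 * pi)) *\<^sub>R (of_real (exp (- u\<^sup>2 / 2)) * iexp (- (u * x))))"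
    by (simp add: std_normal_density_def scaleR_conv_of_real mult_ac)
  also have "\<dots> = (1 / sqrt (2 * pi)) *\<^sub>R (LINT u|lborel. of_real (exp (- u\<^sup>2 / 2)) * iexp (- (u * x)))"
    by (rule integral_scaleR_right)
  finally show ?thesis by (simp add: scaleR_conv_of_real field_simps)
qed

lemma integral_gauss: "(LINT u|lborel. exp (- u\<^sup>2 / 2)) = sqrt (2 * pi)"
proof -
  have "complex_of_real (LINT u|lborel. exp (- u\<^sup>2 / 2)) = sqrt (2 * pi)"
    using fourier_gauss[of 0] by (simp add: integral_of_real[symmetric] del: integral_of_real)
  then show ?thesis by (simp only: of_real_eq_iff)
qed

lemma borel_measurable_bern_prod [measurable]:
  assumes [measurable]: "f \<in> borel_measurable M" "g \<in> borel_measurable M"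
  shows "(\<lambda>w. bern_prod q n d (f w) (g w)) \<in> borel_measurable M"
  unfolding bern_prod_def bern_cf_def by measurable

lemma borel_measurable_subset_cf [measurable]:
  assumes [measurable]: "f \<in> borel_measurable M"
  shows "(\<lambda>w. subset_cf m n d (f w)) \<in> borel_measurable M"
  unfolding subset_cf_def by measurable

section \<open>Arrays of sequences\<close>

text \<open>The setting of all asymptotic statements below, with the Lindeberg condition in terms of
  the named tail.\<close>
locale sampling_array =
  fixes n m :: "nat \<Rightarrow> nat" and d :: "nat \<Rightarrow> nat \<Rightarrow> int" and p :: "int pmf"
  assumes m_le: "\<And>\<kappa>. \<kappa> \<ge> 1 \<Longrightarrow> m \<kappa> \<le> n \<kappa>"
    and Q_pos: "\<And>\<kappa>. \<kappa> \<ge> 1 \<Longrightarrow> seq_Q (n \<kappa>) (d \<kappa>) > 0"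
    and p_lim: "\<And>k::int. (\<lambda>\<kappa>. rel_freq (n \<kappa>) (d \<kappa>) k) \<longlonglongrightarrow> pmf p k"
    and nonlat: "nonlattice p"
    and Q_O: "(\<lambda>\<kappa>. seq_Q (n \<kappa>) (d \<kappa>)) \<in> O(\<lambda>\<kappa>. real (n \<kappa>))"
    and lindeberg: "\<And>\<epsilon>::real. \<epsilon> > 0 \<Longrightarrow> (\<lambda>\<kappa>. lindeberg_tail (m \<kappa>) (n \<kappa>) (d \<kappa>) \<epsilon>) \<longlonglongrightarrow> 0"
begin

definition q :: "nat \<Rightarrow> real" where "q \<kappa> = real (m \<kappa>) / real (n \<kappa>)"
definition Q :: "nat \<Rightarrow> real" where "Q \<kappa> = seq_Q (n \<kappa>) (d \<kappa>)"
definition \<mu> :: "nat \<Rightarrow> real" where "\<mu> \<kappa> = seq_mean (n \<kappa>) (d \<kappa>)"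
definition \<sigma> :: "nat \<Rightarrow> real" where "\<sigma> \<kappa> = sigma_hat (m \<kappa>) (n \<kappa>) (d \<kappa>)"
text \<open>The standard deviation of the number of successes.\<close>
definition v :: "nat \<Rightarrow> real" where "v \<kappa> = sqrt (n \<kappa> * (q \<kappa> * (1 - q \<kappa>)))"

lemma eventually_Q_pos: "\<forall>\<^sub>F \<kappa> in sequentially. Q \<kappa> > 0"
  using eventually_ge_at_top[of 1] by eventually_elim (simp add: Q_def Q_pos)

lemma eventually_q_range: "\<forall>\<^sub>F \<kappa> in sequentially. 0 \<le> q \<kappa> \<and> q \<kappa> \<le> 1"
  using eventually_ge_at_top[of 1]
  by eventually_elim (auto simp: q_def m_le divide_le_eq_1)

lemma eventually_n_pos: "\<forall>\<^sub>F \<kappa> in sequentially. 0 < n \<kappa>"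
  using eventually_Q_pos by eventually_elim (auto simp: Q_def seq_Q_def intro: Nat.gr0I)

lemma eventually_Q_upper: "\<exists>C>0::real. \<forall>\<^sub>F \<kappa> in sequentially. Q \<kappa> \<le> C * real (n \<kappa>)"
proof -
  obtain C where "C > 0" "\<forall>\<^sub>F \<kappa> in sequentially. norm (seq_Q (n \<kappa>) (d \<kappa>)) \<le> C * norm (real (n \<kappa>))"
    using landau_o.bigE[OF Q_O] by blast
  then show ?thesis
    by (intro exI[of _ C] conjI) (auto simp: Q_def elim!: eventually_mono)
qed

lemma eventually_rel_freq_ge:
  assumes "finite K" "K \<subseteq> set_pmf p"
  shows "\<exists>\<delta>>0::real. \<forall>\<^sub>F \<kappa> in sequentially. \<forall>k\<in>K. \<delta> \<le> rel_freq (n \<kappa>) (d \<kappa>) k"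
proof -
  define \<delta> where "\<delta> = Min (insert 1 (pmf p ` K)) / 2"
  have min: "Min (insert 1 (pmf p ` K)) > 0"
    using assms by (auto simp: pmf_positive_iff)
  have "\<delta> < pmf p k" if "k \<in> K" for k
  proof -
    have "Min (insert 1 (pmf p ` K)) \<le> pmf p k"
      using assms(1) that by (intro Min_le) auto
    then show ?thesis using min by (simp add: \<delta>_def)
  qed
  then have "\<forall>\<^sub>F \<kappa> in sequentially. \<delta> \<le> rel_freq (n \<kappa>) (d \<kappa>) k" if "k \<in> K" for k
    by (rule eventually_mono[OF order_tendstoD(1)[OF p_lim]]) (use that in auto)
  then have "\<forall>\<^sub>F \<kappa> in sequentially. \<forall>k\<in>K. \<delta> \<le> rel_freq (n \<kappa>) (d \<kappa>) k"
    using assms(1) by (simp add: eventually_ball_finite)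
  moreover have "\<delta> > 0" using min by (simp add: \<delta>_def)
  ultimately show ?thesis by blast
qed

text \<open>Finitely many atoms of the limit distribution already account for a positive proportion of
  each sequence, uniformly over the nonnegative functions \<open>g\<close> to be averaged. All lower
  bounds of order \<open>n\<close> below come from this.\<close>
lemma eventually_sum_values_ge:
  assumes "finite K" "K \<subseteq> set_pmf p"
  shows "\<exists>\<delta>>0::real. \<forall>\<^sub>F \<kappa> in sequentially. \<forall>g::int \<Rightarrow> real. (\<forall>k. g k \<ge> 0) \<longrightarrow>
    \<delta> * real (n \<kappa>) * (\<Sum>k\<in>K. g k) \<le> (\<Sum>i=1..n \<kappa>. g (d \<kappa> i))"
proof -
  obtain \<delta> where "\<delta> > 0" and \<delta>: "\<forall>\<^sub>F \<kappa> in sequentially. \<forall>k\<in>K. \<delta> \<le> rel_freq (n \<kappa>) (d \<kappa>) k"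
    using eventually_rel_freq_ge[OF assms] by blast
  from \<delta> have "\<forall>\<^sub>F \<kappa> in sequentially. \<forall>g::int \<Rightarrow> real. (\<forall>k. g k \<ge> 0) \<longrightarrow>
    \<delta> * real (n \<kappa>) * (\<Sum>k\<in>K. g k) \<le> (\<Sum>i=1..n \<kappa>. g (d \<kappa> i))"
  proof (eventually_elim, intro allI impI)
    fix \<kappa> and g :: "int \<Rightarrow> real"
    assume *: "\<forall>k\<in>K. \<delta> \<le> rel_freq (n \<kappa>) (d \<kappa>) k" and g: "\<forall>k. g k \<ge> 0"
    have "\<delta> * real (n \<kappa>) * (\<Sum>k\<in>K. g k) = (\<Sum>k\<in>K. real (n \<kappa>) * \<delta> * g k)"
      unfolding sum_distrib_left by (simp add: mult_ac)
    also have "\<dots> \<le> (\<Sum>k\<in>K. n \<kappa> * rel_freq (n \<kappa>) (d \<kappa>) k * g k)"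
      using * g by (intro sum_mono mult_right_mono mult_left_mono) auto
    also have "\<dots> \<le> (\<Sum>i=1..n \<kappa>. g (d \<kappa> i))"
      using g by (intro sum_values_ge assms) auto
    finally show "\<delta> * real (n \<kappa>) * (\<Sum>k\<in>K. g k) \<le> (\<Sum>i=1..n \<kappa>. g (d \<kappa> i))" .
  qed
  with \<open>\<delta> > 0\<close> show ?thesis by blast
qed

lemma two_atoms: obtains a b where "a \<in> set_pmf p" "b \<in> set_pmf p" "a \<noteq> b"
proof -
  obtain a where "a \<in> set_pmf p" using set_pmf_not_empty[of p] by blast
  moreover have "set_pmf p \<noteq> {a}"
    using Gcd_differences_of_nonlattice[OF nonlat] by auto
  ultimately show thesis using that by blast
qed

text \<open>A value that occurs with positive limit frequency cannot be far from the mean,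
  since \<open>Q = O(n)\<close>.\<close>
lemma eventually_mean_bounded: "\<exists>M\<ge>0. \<forall>\<^sub>F \<kappa> in sequentially. \<bar>\<mu> \<kappa>\<bar> \<le> M"
proof -
  obtain a where "a \<in> set_pmf p" using set_pmf_not_empty[of p] by blast
  then obtain \<delta> where \<delta>: "\<delta> > 0" "\<forall>\<^sub>F \<kappa> in sequentially. \<forall>g::int \<Rightarrow> real. (\<forall>k. g k \<ge> 0) \<longrightarrow>
    \<delta> * real (n \<kappa>) * (\<Sum>k\<in>{a}. g k) \<le> (\<Sum>i=1..n \<kappa>. g (d \<kappa> i))"
    using eventually_sum_values_ge[of "{a}"] by auto
  obtain C where C: "C > 0" "\<forall>\<^sub>F \<kappa> in sequentially. Q \<kappa> \<le> C * real (n \<kappa>)"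
    using eventually_Q_upper by blast
  have "\<forall>\<^sub>F \<kappa> in sequentially. \<bar>\<mu> \<kappa>\<bar> \<le> \<bar>real_of_int a\<bar> + sqrt (C / \<delta>)"
    using \<delta>(2) C(2) eventually_n_pos
  proof eventually_elim
    case (elim \<kappa>)
    have "\<delta> * real (n \<kappa>) * (real_of_int a - \<mu> \<kappa>)\<^sup>2 \<le> Q \<kappa>"
      using elim(1)[rule_format, of "\<lambda>k. (real_of_int k - \<mu> \<kappa>)\<^sup>2"] by (simp add: Q_def seq_Q_def \<mu>_def)
    with elim(2) have "n \<kappa> * (\<delta> * (real_of_int a - \<mu> \<kappa>)\<^sup>2) \<le> n \<kappa> * C"
      by (simp add: mult_ac)
    then have "(real_of_int a - \<mu> \<kappa>)\<^sup>2 \<le> C / \<delta>"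
      using elim(3) \<delta>(1) by (simp add: pos_le_divide_eq mult.commute)
    then have "\<bar>real_of_int a - \<mu> \<kappa>\<bar> \<le> sqrt (C / \<delta>)"
      using real_sqrt_le_mono by fastforce
    then show ?case by linarith
  qed
  moreover have "\<bar>real_of_int a\<bar> + sqrt (C / \<delta>) \<ge> 0"
    using C(1) \<delta>(1) by simp
  ultimately show ?thesis by blast
qed

text \<open>Two distinct integer atoms cannot both be close to the mean.\<close>
lemma eventually_Q_lower: "\<exists>c>0::real. \<forall>\<^sub>F \<kappa> in sequentially. c * real (n \<kappa>) \<le> Q \<kappa>"
proof -
  obtain a b where ab: "a \<in> set_pmf p" "b \<in> set_pmf p" "a \<noteq> b"
    using two_atoms by blast
  then obtain \<delta> where \<delta>: "\<delta> > 0" "\<forall>\<^sub>F \<kappa> in sequentially. \<forall>g::int \<Rightarrow> real. (\<forall>k. g k \<ge> 0) \<longrightarrow>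
    \<delta> * real (n \<kappa>) * (\<Sum>k\<in>{a, b}. g k) \<le> (\<Sum>i=1..n \<kappa>. g (d \<kappa> i))"
    using eventually_sum_values_ge[of "{a, b}"] by auto
  have "\<forall>\<^sub>F \<kappa> in sequentially. \<delta> / 2 * real (n \<kappa>) \<le> Q \<kappa>"
    using \<delta>(2)
  proof eventually_elim
    case (elim \<kappa>)
    let ?x = "real_of_int a - \<mu> \<kappa>" and ?y = "real_of_int b - \<mu> \<kappa>"
    have "1 \<le> \<bar>a - b\<bar>" using ab(3) by linarith
    then have "1 \<le> \<bar>?x - ?y\<bar>" by linarith
    then have "1 \<le> (?x - ?y)\<^sup>2"
      using power_mono[of 1 "\<bar>?x - ?y\<bar>" 2] by simp
    also have "\<dots> \<le> 2 * (?x\<^sup>2 + ?y\<^sup>2)"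
      using zero_le_power2[of "?x + ?y"] by (simp add: power2_eq_square algebra_simps)
    finally have "\<delta> * real (n \<kappa>) * (1 / 2) \<le> \<delta> * real (n \<kappa>) * (?x\<^sup>2 + ?y\<^sup>2)"
      using \<delta>(1) by (intro mult_left_mono) auto
    also have "\<dots> \<le> Q \<kappa>"
      using elim[rule_format, of "\<lambda>k. (real_of_int k - \<mu> \<kappa>)\<^sup>2"] ab(3) by (simp add: Q_def seq_Q_def \<mu>_def)
    finally show ?case by simp
  qed
  with \<delta>(1) show ?thesis by (intro exI[of _ "\<delta> / 2"]) auto
qed

lemma eventually_sum_cos_ge:
  "\<exists>c>0::real. \<forall>\<^sub>F \<kappa> in sequentially. \<forall>s t. \<bar>s\<bar> \<le> pi \<longrightarrow> \<bar>t\<bar> \<le> pi \<longrightarrow>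
     c * real (n \<kappa>) * (s\<^sup>2 + t\<^sup>2) \<le> (\<Sum>i=1..n \<kappa>. 1 - cos (s + t * of_int (d \<kappa> i)))"
proof -
  obtain K c where K: "finite K" "K \<subseteq> set_pmf p" "c > 0" and c:
    "\<And>s t. \<bar>s\<bar> \<le> pi \<Longrightarrow> \<bar>t\<bar> \<le> pi \<Longrightarrow> c * (s\<^sup>2 + t\<^sup>2) \<le> (\<Sum>k\<in>K. 1 - cos (s + t * of_int k))"
    using sum_one_minus_cos_ge[OF Gcd_differences_of_nonlattice[OF nonlat]] by blast
  then obtain \<delta> where \<delta>: "\<delta> > 0" "\<forall>\<^sub>F \<kappa> in sequentially. \<forall>g::int \<Rightarrow> real. (\<forall>k. g k \<ge> 0) \<longrightarrow>
    \<delta> * real (n \<kappa>) * (\<Sum>k\<in>K. g k) \<le> (\<Sum>i=1..n \<kappa>. g (d \<kappa> i))"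
    using eventually_sum_values_ge[of K] by auto
  have "\<forall>\<^sub>F \<kappa> in sequentially. \<forall>s t. \<bar>s\<bar> \<le> pi \<longrightarrow> \<bar>t\<bar> \<le> pi \<longrightarrow>
     \<delta> * c * real (n \<kappa>) * (s\<^sup>2 + t\<^sup>2) \<le> (\<Sum>i=1..n \<kappa>. 1 - cos (s + t * of_int (d \<kappa> i)))"
    using \<delta>(2)
  proof (eventually_elim, intro allI impI)
    fix \<kappa> s t
    assume *: "\<forall>g::int \<Rightarrow> real. (\<forall>k. g k \<ge> 0) \<longrightarrow>
      \<delta> * real (n \<kappa>) * (\<Sum>k\<in>K. g k) \<le> (\<Sum>i=1..n \<kappa>. g (d \<kappa> i))" and st: "\<bar>s\<bar> \<le> pi" "\<bar>t\<bar> \<le> pi"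
    have "\<delta> * real (n \<kappa>) * (c * (s\<^sup>2 + t\<^sup>2)) \<le> \<delta> * real (n \<kappa>) * (\<Sum>k\<in>K. 1 - cos (s + t * of_int k))"
      using \<delta>(1) by (intro mult_left_mono c st) auto
    also have "\<dots> \<le> (\<Sum>i=1..n \<kappa>. 1 - cos (s + t * of_int (d \<kappa> i)))"
      using *[rule_format, of "\<lambda>k. 1 - cos (s + t * of_int k)"] by simp
    finally show "\<delta> * c * real (n \<kappa>) * (s\<^sup>2 + t\<^sup>2) \<le> (\<Sum>i=1..n \<kappa>. 1 - cos (s + t * of_int (d \<kappa> i)))"
      by (simp add: mult_ac)
  qed
  with \<delta>(1) K(3) show ?thesis by (intro exI[of _ "\<delta> * c"]) auto
qed

section \<open>Divergence of the standard deviation\<close>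

lemma sigma_sq: "0 \<le> q \<kappa> \<Longrightarrow> q \<kappa> \<le> 1 \<Longrightarrow> Q \<kappa> > 0 \<Longrightarrow> (\<sigma> \<kappa>)\<^sup>2 = q \<kappa> * (1 - q \<kappa>) * Q \<kappa>"
  by (simp add: \<sigma>_def sigma_hat_def sigma_hat_sq_def q_def[symmetric] Q_def[symmetric])

lemma sigma_nonneg: "0 \<le> q \<kappa> \<Longrightarrow> q \<kappa> \<le> 1 \<Longrightarrow> Q \<kappa> > 0 \<Longrightarrow> 0 \<le> \<sigma> \<kappa>"
  by (simp add: \<sigma>_def sigma_hat_def sigma_hat_sq_def q_def[symmetric] Q_def[symmetric])

lemma v_sq: "0 \<le> q \<kappa> \<Longrightarrow> q \<kappa> \<le> 1 \<Longrightarrow> (v \<kappa>)\<^sup>2 = n \<kappa> * (q \<kappa> * (1 - q \<kappa>))"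
  by (simp add: v_def)

text \<open>If \<open>\<sigma>\<close> stayed bounded, then by the Lindeberg condition almost all of \<open>Q\<close> would come from
  arbitrarily small deviations, contradicting \<open>Q \<ge> c n\<close>.\<close>
lemma sigma_at_top: "filterlim \<sigma> at_top sequentially"
  unfolding filterlim_at_top
proof
  fix Z :: real
  obtain c where c: "c > 0" "\<forall>\<^sub>F \<kappa> in sequentially. c * real (n \<kappa>) \<le> Q \<kappa>"
    using eventually_Q_lower by blast
  \<comment> \<open>With this \<open>\<epsilon>\<close>, the deviations below the threshold contribute at most \<open>Q / 4\<close> if \<open>\<sigma> \<le> B\<close>.\<close>
  define B where "B = max Z 1"
  define \<epsilon> where "\<epsilon> = sqrt (c / 4) / B"
  have "B > 0" by (simp add: B_def)
  then have \<epsilon>: "\<epsilon> > 0" "\<epsilon>\<^sup>2 * B\<^sup>2 = c / 4"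
    using c(1) by (simp_all add: \<epsilon>_def power_divide)
  have "\<forall>\<^sub>F \<kappa> in sequentially. lindeberg_tail (m \<kappa>) (n \<kappa>) (d \<kappa>) \<epsilon> < 1 / 2"
    using lindeberg[OF \<epsilon>(1)] by (rule order_tendstoD) simp
  then show "\<forall>\<^sub>F \<kappa> in sequentially. Z \<le> \<sigma> \<kappa>"
    using c(2) eventually_Q_pos eventually_q_range eventually_n_pos
  proof eventually_elim
    case (elim \<kappa>)
    have \<sigma>: "0 \<le> \<sigma> \<kappa>" using elim sigma_nonneg by blast
    show ?case
    proof (rule ccontr)
      assume "\<not> Z \<le> \<sigma> \<kappa>"
      then have "(\<sigma> \<kappa>)\<^sup>2 \<le> B\<^sup>2" using \<sigma> by (intro power_mono) (auto simp: B_def)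
      then have "n \<kappa> * (\<epsilon> * \<sigma> \<kappa>)\<^sup>2 \<le> n \<kappa> * (\<epsilon>\<^sup>2 * B\<^sup>2)"
        by (simp add: power_mult_distrib mult_left_mono)
      also have "\<dots> = n \<kappa> * c / 4" unfolding \<epsilon>(2) by simp
      also have "\<dots> \<le> Q \<kappa> / 4" using elim(2) by (simp add: mult.commute)
      finally have 1: "n \<kappa> * (\<epsilon> * \<sigma> \<kappa>)\<^sup>2 \<le> Q \<kappa> / 4" .
      have "Q \<kappa> * lindeberg_tail (m \<kappa>) (n \<kappa>) (d \<kappa>) \<epsilon> \<le> Q \<kappa> * (1 / 2)"
        using elim by (intro mult_left_mono) auto
      moreover have "Q \<kappa> \<le> Q \<kappa> * lindeberg_tail (m \<kappa>) (n \<kappa>) (d \<kappa>) \<epsilon> + n \<kappa> * (\<epsilon> * \<sigma> \<kappa>)\<^sup>2"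
        unfolding Q_def \<sigma>_def
        by (rule seq_Q_le_tail) (use \<epsilon> \<sigma> elim in \<open>simp_all add: \<sigma>_def Q_def\<close>)
      ultimately show False using 1 elim(3) by linarith
    qed
  qed
qed

lemma eventually_sigma_le_v: "\<exists>C>0::real. \<forall>\<^sub>F \<kappa> in sequentially. \<sigma> \<kappa> \<le> C * v \<kappa>"
proof -
  obtain C where C: "C > 0" "\<forall>\<^sub>F \<kappa> in sequentially. Q \<kappa> \<le> C * real (n \<kappa>)"
    using eventually_Q_upper by blast
  have "\<forall>\<^sub>F \<kappa> in sequentially. \<sigma> \<kappa> \<le> sqrt C * v \<kappa>"
    using C(2) eventually_Q_pos eventually_q_range
  proof eventually_elim
    case (elim \<kappa>)
    have "(\<sigma> \<kappa>)\<^sup>2 \<le> (sqrt C * v \<kappa>)\<^sup>2"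
      using elim C(1) mult_left_mono[OF elim(1), of "q \<kappa> * (1 - q \<kappa>)"]
      by (simp add: sigma_sq v_sq power_mult_distrib mult_ac)
    then show ?case
      by (rule power2_le_imp_le) (use C elim in \<open>simp add: v_def\<close>)
  qed
  with C(1) show ?thesis by (intro exI[of _ "sqrt C"]) auto
qed

lemma v_at_top: "filterlim v at_top sequentially"
proof -
  obtain C where C: "C > 0" "\<forall>\<^sub>F \<kappa> in sequentially. \<sigma> \<kappa> \<le> C * v \<kappa>"
    using eventually_sigma_le_v by blast
  have "filterlim (\<lambda>\<kappa>. (1 / C) * \<sigma> \<kappa>) at_top sequentially"
    using C(1) by (intro filterlim_tendsto_pos_mult_at_top[OF tendsto_const _ sigma_at_top]) auto
  then show ?thesis
    by (rule filterlim_at_top_mono)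
       (use C in \<open>auto elim!: eventually_mono simp: field_simps\<close>)
qed

lemma eventually_sigma_pos: "\<forall>\<^sub>F \<kappa> in sequentially. \<sigma> \<kappa> > 0"
  using sigma_at_top by (simp add: filterlim_at_top_dense)

lemma eventually_v_pos: "\<forall>\<^sub>F \<kappa> in sequentially. v \<kappa> > 0"
  using v_at_top by (simp add: filterlim_at_top_dense)

lemma eventually_q_inner: "\<forall>\<^sub>F \<kappa> in sequentially. 0 < q \<kappa> \<and> q \<kappa> < 1"
proof -
  have "\<forall>\<^sub>F \<kappa> in sequentially. v \<kappa> > 0"
    by (rule eventually_v_pos)
  then show ?thesis
    using eventually_q_range
  proof eventually_elim
    case (elim \<kappa>)
    then have "q \<kappa> \<noteq> 0" "q \<kappa> \<noteq> 1" by (auto simp: v_def)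
    then show ?case using elim by auto
  qed
qed

section \<open>Convergence and domination of the characteristic functions\<close>

definition scaled_prod :: "nat \<Rightarrow> real \<Rightarrow> real \<Rightarrow> complex" where
  "scaled_prod \<kappa> w u = bern_prod (q \<kappa>) (n \<kappa>) (d \<kappa>) (w / v \<kappa>) (u / \<sigma> \<kappa>)"

lemma scaled_prod_tendsto: "(\<lambda>\<kappa>. scaled_prod \<kappa> w u) \<longlonglongrightarrow> of_real (exp (- (w\<^sup>2 + u\<^sup>2) / 2))"
proof (rule tendstoI)
  fix e :: real assume "e > 0"
  define \<delta> where "\<delta> = e / (4 * (w\<^sup>2 + u\<^sup>2 + 1))"
  define \<epsilon> where "\<epsilon> = \<delta> / (2 * (\<bar>u\<bar> + 1))"
  have pos: "w\<^sup>2 + u\<^sup>2 + 1 > 0" by (simp add: add_nonneg_pos)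
  have \<delta>: "\<delta> > 0" using \<open>e > 0\<close> pos by (simp add: \<delta>_def)
  have \<epsilon>: "\<epsilon> > 0" using \<delta> by (simp add: \<epsilon>_def)
  have "\<bar>u\<bar> * \<epsilon> \<le> (\<bar>u\<bar> + 1) * \<epsilon>" using \<epsilon> by (intro mult_right_mono) auto
  also have "\<dots> = \<delta> / 2" by (simp add: \<epsilon>_def field_simps)
  finally have u: "\<bar>u\<bar> * \<epsilon> \<le> \<delta> / 2" .
  have "2 * \<delta> * (w\<^sup>2 + u\<^sup>2) \<le> 2 * \<delta> * (w\<^sup>2 + u\<^sup>2 + 1)"
    using \<delta> by (intro mult_left_mono) auto
  also have "\<dots> = e / 2" using pos by (simp add: \<delta>_def field_simps)
  finally have e: "2 * \<delta> * (w\<^sup>2 + u\<^sup>2) \<le> e / 2" .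
  have "(\<lambda>\<kappa>. 8 * u\<^sup>2 * lindeberg_tail (m \<kappa>) (n \<kappa>) (d \<kappa>) \<epsilon>) \<longlonglongrightarrow> 8 * u\<^sup>2 * 0"
    by (intro tendsto_intros lindeberg \<epsilon>)
  then have "\<forall>\<^sub>F \<kappa> in sequentially. 8 * u\<^sup>2 * lindeberg_tail (m \<kappa>) (n \<kappa>) (d \<kappa>) \<epsilon> < e / 2"
    by (rule order_tendstoD) (use \<open>e > 0\<close> in simp)
  moreover have "(\<lambda>\<kappa>. \<bar>w\<bar> / v \<kappa>) \<longlonglongrightarrow> 0"
    by (rule real_tendsto_divide_at_top[OF tendsto_const v_at_top])
  then have "\<forall>\<^sub>F \<kappa> in sequentially. \<bar>w\<bar> / v \<kappa> < \<delta> / 2"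
    by (rule order_tendstoD) (use \<delta> in simp)
  ultimately show "\<forall>\<^sub>F \<kappa> in sequentially. dist (scaled_prod \<kappa> w u) (of_real (exp (- (w\<^sup>2 + u\<^sup>2) / 2))) < e"
    using eventually_q_inner eventually_Q_pos
  proof eventually_elim
    case (elim \<kappa>)
    have "dist (scaled_prod \<kappa> w u) (of_real (exp (- (w\<^sup>2 + u\<^sup>2) / 2)))
        \<le> 2 * \<delta> * (w\<^sup>2 + u\<^sup>2) + 8 * u\<^sup>2 * lindeberg_tail (m \<kappa>) (n \<kappa>) (d \<kappa>) \<epsilon>"
      unfolding dist_norm scaled_prod_def \<sigma>_def q_def v_def
      by (rule norm_bern_prod_minus_gauss) (use elim u in \<open>auto simp: q_def Q_def v_def\<close>)
    then show ?case using elim(1) e by linarith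
  qed
qed

text \<open>For \<open>t = u / \<sigma>\<close>, the centred arguments are \<open>s + t a\<^sub>i = (s - t \<mu>) + t d\<^sub>i\<close>. The period in \<open>s\<close> is
  therefore centred at \<open>t \<mu>\<close>, so that \<open>s - t \<mu>\<close> lies in \<open>[-\<pi>, \<pi>]\<close>, where the lower bound
  for integer data applies.\<close>
definition region :: "nat \<Rightarrow> real \<Rightarrow> real set" where
  "region \<kappa> u = {w. w / v \<kappa> \<in> {u / \<sigma> \<kappa> * \<mu> \<kappa> - pi..u / \<sigma> \<kappa> * \<mu> \<kappa> + pi}}"

text \<open>The shift by \<open>t \<mu>\<close> costs only a constant factor \<open>D\<close> because the means are bounded, and
  \<open>Q = O(n)\<close> compares the two scales by \<open>\<sigma> \<le> C v\<close>.\<close>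
lemma scaled_prod_bound:
  "\<exists>c>0. \<forall>\<^sub>F \<kappa> in sequentially. \<forall>w u. \<bar>u\<bar> \<le> pi * \<sigma> \<kappa> \<longrightarrow> w \<in> region \<kappa> u \<longrightarrow>
     norm (scaled_prod \<kappa> w u) \<le> exp (- (c * (w\<^sup>2 + u\<^sup>2)))"
proof -
  obtain c where c: "c > 0" "\<forall>\<^sub>F \<kappa> in sequentially. \<forall>s t. \<bar>s\<bar> \<le> pi \<longrightarrow> \<bar>t\<bar> \<le> pi \<longrightarrow>
     c * real (n \<kappa>) * (s\<^sup>2 + t\<^sup>2) \<le> (\<Sum>i=1..n \<kappa>. 1 - cos (s + t * of_int (d \<kappa> i)))"
    using eventually_sum_cos_ge by blast
  obtain M where M: "M \<ge> 0" "\<forall>\<^sub>F \<kappa> in sequentially. \<bar>\<mu> \<kappa>\<bar> \<le> M"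
    using eventually_mean_bounded by blast
  obtain C where C: "C > 0" "\<forall>\<^sub>F \<kappa> in sequentially. \<sigma> \<kappa> \<le> C * v \<kappa>"
    using eventually_sigma_le_v by blast
  \<comment> \<open>From \<open>s\<^sup>2 \<le> 2 (s - t \<mu>)\<^sup>2 + 2 M\<^sup>2 t\<^sup>2\<close>.\<close>
  define D where "D = 3 + 2 * M\<^sup>2"
  define e where "e = min 1 (1 / C\<^sup>2)"
  have D: "D > 0" by (simp add: D_def add_pos_nonneg)
  have e: "e > 0" using C(1) by (simp add: e_def)
  have "\<forall>\<^sub>F \<kappa> in sequentially. \<sigma> \<kappa> > 0"
    by (rule eventually_sigma_pos)
  moreover have "\<forall>\<^sub>F \<kappa> in sequentially. v \<kappa> > 0"
    by (rule eventually_v_pos)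
  ultimately have "\<forall>\<^sub>F \<kappa> in sequentially. \<forall>w u. \<bar>u\<bar> \<le> pi * \<sigma> \<kappa> \<longrightarrow> w \<in> region \<kappa> u \<longrightarrow>
     norm (scaled_prod \<kappa> w u) \<le> exp (- (c / D * e * (w\<^sup>2 + u\<^sup>2)))"
    using c(2) M(2) C(2) eventually_q_inner
  proof (eventually_elim, intro allI impI)
    fix \<kappa> w u
    assume pos: "\<sigma> \<kappa> > 0" "v \<kappa> > 0"
      and cos: "\<forall>s t. \<bar>s\<bar> \<le> pi \<longrightarrow> \<bar>t\<bar> \<le> pi \<longrightarrow>
        c * real (n \<kappa>) * (s\<^sup>2 + t\<^sup>2) \<le> (\<Sum>i=1..n \<kappa>. 1 - cos (s + t * of_int (d \<kappa> i)))"
      and \<mu>: "\<bar>\<mu> \<kappa>\<bar> \<le> M" and \<sigma>v: "\<sigma> \<kappa> \<le> C * v \<kappa>" and q: "0 < q \<kappa> \<and> q \<kappa> < 1"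
      and u: "\<bar>u\<bar> \<le> pi * \<sigma> \<kappa>" and w: "w \<in> region \<kappa> u"
    define t where "t = u / \<sigma> \<kappa>"
    define s where "s = w / v \<kappa>"
    define s' where "s' = s - t * \<mu> \<kappa>"
    have t: "\<bar>t\<bar> \<le> pi" using u pos by (simp add: t_def field_simps)
    have s': "\<bar>s'\<bar> \<le> pi" using w by (auto simp: s'_def s_def t_def region_def abs_le_iff)
    have "s\<^sup>2 = (s' + t * \<mu> \<kappa>)\<^sup>2" by (simp add: s'_def)
    also have "\<dots> \<le> 2 * s'\<^sup>2 + 2 * (t * \<mu> \<kappa>)\<^sup>2"
      using zero_le_power2[of "s' - t * \<mu> \<kappa>"] by (simp add: power2_eq_square algebra_simps)
    also have "(t * \<mu> \<kappa>)\<^sup>2 \<le> t\<^sup>2 * M\<^sup>2"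
      using power_mono[OF \<mu>, of 2] by (simp add: power_mult_distrib mult_left_mono)
    finally have "s\<^sup>2 + t\<^sup>2 \<le> 2 * s'\<^sup>2 + (1 + 2 * M\<^sup>2) * t\<^sup>2"
      by (simp add: algebra_simps)
    also have "\<dots> \<le> D * s'\<^sup>2 + D * t\<^sup>2"
      by (intro add_mono mult_right_mono) (simp_all add: D_def add_increasing2)
    finally have "(s\<^sup>2 + t\<^sup>2) / D \<le> s'\<^sup>2 + t\<^sup>2"
      using D by (simp add: pos_divide_le_eq algebra_simps)
    then have "c * real (n \<kappa>) * ((s\<^sup>2 + t\<^sup>2) / D) \<le> c * real (n \<kappa>) * (s'\<^sup>2 + t\<^sup>2)"
      using c(1) by (intro mult_left_mono) auto
    also have "\<dots> \<le> (\<Sum>i=1..n \<kappa>. 1 - cos (s' + t * of_int (d \<kappa> i)))"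
      using cos s' t by blast
    also have "\<dots> = (\<Sum>i=1..n \<kappa>. 1 - cos (s + t * deviation (n \<kappa>) (d \<kappa>) i))"
      by (simp add: s'_def deviation_def \<mu>_def algebra_simps)
    finally have *: "c * real (n \<kappa>) * ((s\<^sup>2 + t\<^sup>2) / D) \<le> \<dots>" .
    have "e * w\<^sup>2 \<le> 1 * w\<^sup>2" by (intro mult_right_mono) (simp_all add: e_def)
    moreover have "e * u\<^sup>2 \<le> 1 / C\<^sup>2 * u\<^sup>2" by (intro mult_right_mono) (simp_all add: e_def)
    moreover have "1 / C\<^sup>2 * u\<^sup>2 \<le> (v \<kappa>)\<^sup>2 * t\<^sup>2"
      using power_mono[OF \<sigma>v, of 2] pos C(1) mult_right_mono[of "(\<sigma> \<kappa>)\<^sup>2" "(C * v \<kappa>)\<^sup>2" "u\<^sup>2"]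
      by (simp add: t_def power_divide power_mult_distrib field_simps)
    moreover have "w\<^sup>2 = (v \<kappa>)\<^sup>2 * s\<^sup>2"
      using pos by (simp add: s_def power_divide)
    ultimately have "e * (w\<^sup>2 + u\<^sup>2) \<le> (v \<kappa>)\<^sup>2 * (s\<^sup>2 + t\<^sup>2)"
      by (simp add: algebra_simps)
    then have "c / D * (e * (w\<^sup>2 + u\<^sup>2)) \<le> c / D * ((v \<kappa>)\<^sup>2 * (s\<^sup>2 + t\<^sup>2))"
      using c(1) D by (intro mult_left_mono) auto
    also have "\<dots> = q \<kappa> * (1 - q \<kappa>) * (c * real (n \<kappa>) * ((s\<^sup>2 + t\<^sup>2) / D))"
      using q by (simp add: v_sq mult_ac)
    also have "\<dots> \<le> q \<kappa> * (1 - q \<kappa>) * (\<Sum>i=1..n \<kappa>. 1 - cos (s + t * deviation (n \<kappa>) (d \<kappa>) i))"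
      using q by (intro mult_left_mono *) auto
    finally show "norm (scaled_prod \<kappa> w u) \<le> exp (- (c / D * e * (w\<^sup>2 + u\<^sup>2)))"
      unfolding scaled_prod_def s_def[symmetric] t_def[symmetric]
      by (intro order_trans[OF norm_bern_prod_le]) (simp add: mult.assoc)
  qed
  moreover have "c / D * e > 0" using c(1) D e by simp
  ultimately show ?thesis by blast
qed

text \<open>The normalizing factor of \<open>lborel_integral_bern_prod\<close> after the substitution \<open>s = w / v\<close>.
  Since \<open>q\<^sup>m (1 - q)\<^bsup>n - m\<^esup> (n choose m)\<close> is the binomial probability of \<open>m\<close> successes, the limit of
  \<open>Z \<kappa>\<close> times the binomial coefficient is the local limit theorem for the binomial distribution at its
  mean; here it is the case \<open>u = 0\<close> of \<open>scaled_cf_tendsto\<close>.\<close>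
definition Z :: "nat \<Rightarrow> real" where
  "Z \<kappa> = v \<kappa> * (2 * pi * (q \<kappa> ^ m \<kappa> * (1 - q \<kappa>) ^ (n \<kappa> - m \<kappa>)))"

lemma eventually_integral_scaled_prod:
  "\<forall>\<^sub>F \<kappa> in sequentially. \<forall>u.
     (LINT w|lborel. indicator (region \<kappa> u) w *\<^sub>R scaled_prod \<kappa> w u) = Z \<kappa> * subset_cf (m \<kappa>) (n \<kappa>) (d \<kappa>) (u / \<sigma> \<kappa>)"
proof -
  have "\<forall>\<^sub>F \<kappa> in sequentially. v \<kappa> > 0"
    by (rule eventually_v_pos)
  then show ?thesis
    using eventually_n_pos eventually_ge_at_top[of 1]
  proof (eventually_elim, intro allI)
    fix \<kappa> u assume v: "v \<kappa> > 0" and n: "0 < n \<kappa>" and "1 \<le> \<kappa>"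
    let ?t = "u / \<sigma> \<kappa>"
    let ?g = "\<lambda>s. indicator {?t * \<mu> \<kappa> - pi..?t * \<mu> \<kappa> + pi} s *\<^sub>R bern_prod (q \<kappa>) (n \<kappa>) (d \<kappa>) s ?t"
    have "2 * pi * (q \<kappa> ^ m \<kappa> * (1 - q \<kappa>) ^ (n \<kappa> - m \<kappa>)) * subset_cf (m \<kappa>) (n \<kappa>) (d \<kappa>) ?t
        = (LINT s|lborel. ?g s)"
      unfolding q_def by (rule lborel_integral_bern_prod[OF m_le n, symmetric]) fact
    also have "\<dots> = \<bar>1 / v \<kappa>\<bar> *\<^sub>R (LINT w|lborel. ?g (0 + 1 / v \<kappa> * w))"
      by (rule lborel_integral_real_affine) (use v in simp)
    also have "(LINT w|lborel. ?g (0 + 1 / v \<kappa> * w)) = (LINT w|lborel. indicator (region \<kappa> u) w *\<^sub>R scaled_prod \<kappa> w u)"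
      by (intro Bochner_Integration.integral_cong) (auto simp: scaled_prod_def region_def indicator_def)
    finally show "(LINT w|lborel. indicator (region \<kappa> u) w *\<^sub>R scaled_prod \<kappa> w u)
        = Z \<kappa> * subset_cf (m \<kappa>) (n \<kappa>) (d \<kappa>) ?t"
      using v by (simp add: Z_def scaleR_conv_of_real field_simps)
  qed
qed

definition \<psi> :: "nat \<Rightarrow> real \<Rightarrow> complex" where
  "\<psi> \<kappa> u = subset_cf (m \<kappa>) (n \<kappa>) (d \<kappa>) (u / \<sigma> \<kappa>)"

lemma region_sets [measurable]: "region \<kappa> u \<in> sets borel"
  unfolding region_def by measurable

lemma eventually_in_region: "\<forall>\<^sub>F \<kappa> in sequentially. \<bar>u\<bar> \<le> pi * \<sigma> \<kappa> \<and> w \<in> region \<kappa> u"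
proof -
  obtain M where M: "M \<ge> 0" "\<forall>\<^sub>F \<kappa> in sequentially. \<bar>\<mu> \<kappa>\<bar> \<le> M"
    using eventually_mean_bounded by blast
  have "(\<lambda>\<kappa>. \<bar>w\<bar> / v \<kappa>) \<longlonglongrightarrow> 0"
    by (rule real_tendsto_divide_at_top[OF tendsto_const v_at_top])
  then have 1: "\<forall>\<^sub>F \<kappa> in sequentially. \<bar>w\<bar> / v \<kappa> < pi / 2"
    by (rule order_tendstoD) simp
  have "(\<lambda>\<kappa>. \<bar>u\<bar> * (M + 1) / \<sigma> \<kappa>) \<longlonglongrightarrow> 0"
    by (rule real_tendsto_divide_at_top[OF tendsto_const sigma_at_top])
  then have 2: "\<forall>\<^sub>F \<kappa> in sequentially. \<bar>u\<bar> * (M + 1) / \<sigma> \<kappa> < pi / 2"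
    by (rule order_tendstoD) simp
  have 3: "\<forall>\<^sub>F \<kappa> in sequentially. \<sigma> \<kappa> > 0"
    by (rule eventually_sigma_pos)
  have 4: "\<forall>\<^sub>F \<kappa> in sequentially. v \<kappa> > 0"
    by (rule eventually_v_pos)
  from 1 2 3 4 M(2) show ?thesis
  proof eventually_elim
    case (elim \<kappa>)
    have "\<bar>u\<bar> * 1 \<le> \<bar>u\<bar> * (M + 1)" using M(1) by (intro mult_left_mono) auto
    also have "\<dots> \<le> pi / 2 * \<sigma> \<kappa>" using elim(2,3) by (simp add: field_simps)
    also have "\<dots> \<le> pi * \<sigma> \<kappa>" using elim(3) by simp
    finally have u: "\<bar>u\<bar> \<le> pi * \<sigma> \<kappa>" by simp
    have "\<bar>u / \<sigma> \<kappa> * \<mu> \<kappa>\<bar> = \<bar>u\<bar> * \<bar>\<mu> \<kappa>\<bar> / \<sigma> \<kappa>" using elim(3) by (simp add: abs_mult)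
    also have "\<dots> \<le> \<bar>u\<bar> * (M + 1) / \<sigma> \<kappa>"
      using elim(3,5) by (intro divide_right_mono mult_left_mono) auto
    finally have "\<bar>u / \<sigma> \<kappa> * \<mu> \<kappa>\<bar> < pi / 2" using elim(2) by linarith
    moreover have "\<bar>w / v \<kappa>\<bar> < pi / 2" using elim(1,4) by simp
    moreover have "a - b \<le> y \<and> y \<le> a + b" if "\<bar>a\<bar> < b / 2" "\<bar>y\<bar> < b / 2" for a b y :: real
      using that by (auto simp: abs_if split: if_splits)
    ultimately have "w \<in> region \<kappa> u"
      unfolding region_def mem_Collect_eq atLeastAtMost_iff by blast
    with u show ?case by simp
  qed
qed

text \<open>Dominated convergence in \<open>w\<close> for fixed \<open>u\<close>. Limit and bound are proved together, as they use
  the same integrand.\<close>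
lemma
  shows scaled_cf_tendsto: "(\<lambda>\<kappa>. Z \<kappa> * \<psi> \<kappa> u) \<longlonglongrightarrow> of_real (sqrt (2 * pi) * exp (- u\<^sup>2 / 2))"
    and scaled_cf_bound: "\<exists>c>0. \<exists>G. \<forall>\<^sub>F \<kappa> in sequentially. \<forall>u. \<bar>u\<bar> \<le> pi * \<sigma> \<kappa> \<longrightarrow>
      norm (Z \<kappa> * \<psi> \<kappa> u) \<le> G * exp (- (c * u\<^sup>2))"
proof -
  obtain c where c: "c > 0" and bound: "\<forall>\<^sub>F \<kappa> in sequentially. \<forall>w u. \<bar>u\<bar> \<le> pi * \<sigma> \<kappa> \<longrightarrow> w \<in> region \<kappa> u \<longrightarrow>
     norm (scaled_prod \<kappa> w u) \<le> exp (- (c * (w\<^sup>2 + u\<^sup>2)))"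
    using scaled_prod_bound by blast
  define good where "good \<kappa> u \<longleftrightarrow> \<bar>u\<bar> \<le> pi * \<sigma> \<kappa> \<and> (\<forall>w \<in> region \<kappa> u.
     norm (scaled_prod \<kappa> w u) \<le> exp (- (c * (w\<^sup>2 + u\<^sup>2))))" for \<kappa> u
  \<comment> \<open>The bound is only eventually true, but dominated convergence asks for it at every index; the
    integrand is set to zero where it fails.\<close>
  define h where "h \<kappa> u w = (if good \<kappa> u then indicator (region \<kappa> u) w *\<^sub>R scaled_prod \<kappa> w u else 0)" for \<kappa> u w
  have dom: "norm (h \<kappa> u w) \<le> exp (- (c * u\<^sup>2)) * exp (- (c * w\<^sup>2))" for \<kappa> u w
  proof -
    have "exp (- (c * (w\<^sup>2 + u\<^sup>2))) = exp (- (c * u\<^sup>2)) * exp (- (c * w\<^sup>2))"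
      by (simp add: exp_add[symmetric] distrib_left)
    then show ?thesis
      by (auto simp: h_def good_def indicator_def)
  qed
  have int: "integrable lborel (\<lambda>w. exp (- (c * u\<^sup>2)) * exp (- (c * w\<^sup>2)))" for u
    using integrable_gauss[OF c] by simp
  have meas: "h \<kappa> u \<in> borel_measurable lborel" for \<kappa> u
    unfolding h_def scaled_prod_def by measurable
  have int_h: "integrable lborel (h \<kappa> u)" for \<kappa> u
    by (rule Bochner_Integration.integrable_bound[OF int meas]) (use dom[of \<kappa> u] in auto)
  have eq: "\<forall>\<^sub>F \<kappa> in sequentially. \<forall>u. \<bar>u\<bar> \<le> pi * \<sigma> \<kappa> \<longrightarrow> (LINT w|lborel. h \<kappa> u w) = Z \<kappa> * \<psi> \<kappa> u"
    using bound eventually_integral_scaled_prod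
    by eventually_elim (auto simp: h_def good_def \<psi>_def)
  have "(\<lambda>\<kappa>. h \<kappa> u w) \<longlonglongrightarrow> of_real (exp (- (w\<^sup>2 + u\<^sup>2) / 2))" for w
  proof (rule Lim_transform_eventually[OF scaled_prod_tendsto])
    show "\<forall>\<^sub>F \<kappa> in sequentially. scaled_prod \<kappa> w u = h \<kappa> u w"
      using bound eventually_in_region[of u w] by eventually_elim (auto simp: h_def good_def)
  qed
  then have "(\<lambda>\<kappa>. LINT w|lborel. h \<kappa> u w) \<longlonglongrightarrow> (LINT w|lborel. complex_of_real (exp (- (w\<^sup>2 + u\<^sup>2) / 2)))"
    by (intro integral_dominated_convergence[OF _ meas int[of u]]) (use dom in auto)
  also have "(LINT w|lborel. complex_of_real (exp (- (w\<^sup>2 + u\<^sup>2) / 2)))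
      = of_real (LINT w|lborel. exp (- w\<^sup>2 / 2) * exp (- u\<^sup>2 / 2))"
    by (simp add: exp_add[symmetric] add_divide_distrib diff_divide_distrib)
  also have "(LINT w|lborel. exp (- w\<^sup>2 / 2) * exp (- u\<^sup>2 / 2)) = sqrt (2 * pi) * exp (- u\<^sup>2 / 2)"
    using integral_gauss by simp
  finally have lim: "(\<lambda>\<kappa>. LINT w|lborel. h \<kappa> u w) \<longlonglongrightarrow> of_real (sqrt (2 * pi) * exp (- u\<^sup>2 / 2))" .
  have "\<forall>\<^sub>F \<kappa> in sequentially. (LINT w|lborel. h \<kappa> u w) = Z \<kappa> * \<psi> \<kappa> u"
    using eq eventually_in_region[of u 0] by eventually_elim auto
  with lim show "(\<lambda>\<kappa>. Z \<kappa> * \<psi> \<kappa> u) \<longlonglongrightarrow> of_real (sqrt (2 * pi) * exp (- u\<^sup>2 / 2))"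
    by (rule Lim_transform_eventually)
  define G where "G = (LINT w|lborel. exp (- (c * w\<^sup>2)))"
  have "norm (LINT w|lborel. h \<kappa> u w) \<le> (LINT w|lborel. exp (- (c * u\<^sup>2)) * exp (- (c * w\<^sup>2)))" for \<kappa> u
    by (rule Bochner_Integration.integral_norm_bound_integral[OF int_h int dom])
  then have "norm (LINT w|lborel. h \<kappa> u w) \<le> G * exp (- (c * u\<^sup>2))" for \<kappa> u
    by (simp add: G_def mult.commute)
  with eq have "\<forall>\<^sub>F \<kappa> in sequentially. \<forall>u. \<bar>u\<bar> \<le> pi * \<sigma> \<kappa> \<longrightarrow>
      norm (Z \<kappa> * \<psi> \<kappa> u) \<le> G * exp (- (c * u\<^sup>2))"
    by (auto elim!: eventually_mono) metis
  with c show "\<exists>c>0. \<exists>G. \<forall>\<^sub>F \<kappa> in sequentially. \<forall>u. \<bar>u\<bar> \<le> pi * \<sigma> \<kappa> \<longrightarrow>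
      norm (Z \<kappa> * \<psi> \<kappa> u) \<le> G * exp (- (c * u\<^sup>2))"
    by blast
qed

lemma psi_0: "\<psi> \<kappa> 0 = (n \<kappa> choose m \<kappa>)"
  by (simp add: \<psi>_def subset_cf_0)

text \<open>The characteristic function of the centred sample sum divided by \<open>\<sigma>\<close>.\<close>
definition \<phi> :: "nat \<Rightarrow> real \<Rightarrow> complex" where
  "\<phi> \<kappa> u = \<psi> \<kappa> u / (n \<kappa> choose m \<kappa>)"

text \<open>Dividing by the value at \<open>u = 0\<close> removes the unknown normalization.\<close>
lemma cf_tendsto: "(\<lambda>\<kappa>. \<phi> \<kappa> u) \<longlonglongrightarrow> of_real (exp (- u\<^sup>2 / 2))"
proof -
  have "(\<lambda>\<kappa>. (Z \<kappa> * \<psi> \<kappa> u) / (Z \<kappa> * \<psi> \<kappa> 0)) \<longlonglongrightarrow>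
      of_real (sqrt (2 * pi) * exp (- u\<^sup>2 / 2)) / of_real (sqrt (2 * pi) * exp (- 0\<^sup>2 / 2))"
    by (intro tendsto_divide scaled_cf_tendsto) simp
  also have "of_real (sqrt (2 * pi) * exp (- u\<^sup>2 / 2)) / of_real (sqrt (2 * pi) * exp (- 0\<^sup>2 / 2)) = complex_of_real (exp (- u\<^sup>2 / 2))"
    by simp
  finally have lim: "(\<lambda>\<kappa>. (Z \<kappa> * \<psi> \<kappa> u) / (Z \<kappa> * \<psi> \<kappa> 0)) \<longlonglongrightarrow> of_real (exp (- u\<^sup>2 / 2))" .
  have "(\<lambda>\<kappa>. Z \<kappa> * \<psi> \<kappa> 0) \<longlonglongrightarrow> of_real (sqrt (2 * pi) * exp (- 0\<^sup>2 / 2))"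
    by (rule scaled_cf_tendsto)
  then have "\<forall>\<^sub>F \<kappa> in sequentially. Z \<kappa> * \<psi> \<kappa> 0 \<noteq> 0"
    by (rule tendsto_imp_eventually_ne) simp
  then have "\<forall>\<^sub>F \<kappa> in sequentially. (Z \<kappa> * \<psi> \<kappa> u) / (Z \<kappa> * \<psi> \<kappa> 0) = \<phi> \<kappa> u"
    unfolding \<phi>_def psi_0[symmetric] by eventually_elim simp
  with lim show ?thesis by (rule Lim_transform_eventually)
qed

lemma cf_bound:
  "\<exists>c>0. \<exists>G. \<forall>\<^sub>F \<kappa> in sequentially. \<forall>u. \<bar>u\<bar> \<le> pi * \<sigma> \<kappa> \<longrightarrow> norm (\<phi> \<kappa> u) \<le> G * exp (- (c * u\<^sup>2))"
proof -
  obtain c G where c: "c > 0" and bound: "\<forall>\<^sub>F \<kappa> in sequentially. \<forall>u. \<bar>u\<bar> \<le> pi * \<sigma> \<kappa> \<longrightarrow>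
      norm (Z \<kappa> * \<psi> \<kappa> u) \<le> G * exp (- (c * u\<^sup>2))"
    using scaled_cf_bound by blast
  have "(\<lambda>\<kappa>. norm (Z \<kappa> * \<psi> \<kappa> 0)) \<longlonglongrightarrow> norm (complex_of_real (sqrt (2 * pi) * exp (- 0\<^sup>2 / 2)))"
    by (intro tendsto_norm scaled_cf_tendsto)
  moreover have "norm (complex_of_real (sqrt (2 * pi) * exp (- 0\<^sup>2 / 2))) > 1"
    using pi_gt3 by (simp add: norm_mult)
  ultimately have "\<forall>\<^sub>F \<kappa> in sequentially. norm (Z \<kappa> * \<psi> \<kappa> 0) > 1"
    by (rule order_tendstoD)
  with bound have "\<forall>\<^sub>F \<kappa> in sequentially. \<forall>u. \<bar>u\<bar> \<le> pi * \<sigma> \<kappa> \<longrightarrow> norm (\<phi> \<kappa> u) \<le> G * exp (- (c * u\<^sup>2))"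
  proof (eventually_elim, intro allI impI)
    fix \<kappa> u
    assume *: "\<forall>u. \<bar>u\<bar> \<le> pi * \<sigma> \<kappa> \<longrightarrow> norm (Z \<kappa> * \<psi> \<kappa> u) \<le> G * exp (- (c * u\<^sup>2))"
      and 1: "norm (Z \<kappa> * \<psi> \<kappa> 0) > 1" and u: "\<bar>u\<bar> \<le> pi * \<sigma> \<kappa>"
    have "Z \<kappa> * \<psi> \<kappa> u = Z \<kappa> * \<psi> \<kappa> 0 * \<phi> \<kappa> u"
    proof -
      have "\<psi> \<kappa> 0 \<noteq> 0" using 1 by auto
      then show ?thesis unfolding \<phi>_def psi_0[symmetric] by simp
    qed
    then have "norm (Z \<kappa> * \<psi> \<kappa> u) = norm (Z \<kappa> * \<psi> \<kappa> 0) * norm (\<phi> \<kappa> u)"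
      by (simp only: norm_mult[of "Z \<kappa> * \<psi> \<kappa> 0"])
    moreover have "1 * norm (\<phi> \<kappa> u) \<le> norm (Z \<kappa> * \<psi> \<kappa> 0) * norm (\<phi> \<kappa> u)"
      using 1 by (intro mult_right_mono) auto
    ultimately show "norm (\<phi> \<kappa> u) \<le> G * exp (- (c * u\<^sup>2))"
      using *[rule_format, OF u] by linarith
  qed
  with c show ?thesis by blast
qed

section \<open>Uniform convergence of the point probabilities\<close>

lemma cf_L1_tendsto:
  "(\<lambda>\<kappa>. LINT u|lborel. norm (indicator {- pi..pi} (u / \<sigma> \<kappa>) *\<^sub>R \<phi> \<kappa> u - of_real (exp (- u\<^sup>2 / 2)))) \<longlonglongrightarrow> 0"
proof -
  obtain c G where c: "c > 0" and bound: "\<forall>\<^sub>F \<kappa> in sequentially. \<forall>u. \<bar>u\<bar> \<le> pi * \<sigma> \<kappa> \<longrightarrow>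
      norm (\<phi> \<kappa> u) \<le> G * exp (- (c * u\<^sup>2))"
    using cf_bound by blast
  have pos: "\<forall>\<^sub>F \<kappa> in sequentially. \<sigma> \<kappa> > 0"
    by (rule eventually_sigma_pos)
  define D where "D \<kappa> u = norm (indicator {- pi..pi} (u / \<sigma> \<kappa>) *\<^sub>R \<phi> \<kappa> u - of_real (exp (- u\<^sup>2 / 2)))" for \<kappa> u
  define w where "w u = \<bar>G\<bar> * exp (- (c * u\<^sup>2)) + exp (- (1/2 * u\<^sup>2))" for u
  have [measurable]: "D \<kappa> \<in> borel_measurable lborel" for \<kappa>
    unfolding D_def \<phi>_def \<psi>_def by measurable
  have "\<forall>\<^sub>F \<kappa> in sequentially. \<forall>u. D \<kappa> u \<le> w u"
    using bound pos
  proof (eventually_elim, intro allI)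
    fix \<kappa> u assume *: "\<forall>u. \<bar>u\<bar> \<le> pi * \<sigma> \<kappa> \<longrightarrow> norm (\<phi> \<kappa> u) \<le> G * exp (- (c * u\<^sup>2))" and "\<sigma> \<kappa> > 0"
    have "norm (indicator {- pi..pi} (u / \<sigma> \<kappa>) *\<^sub>R \<phi> \<kappa> u) \<le> \<bar>G\<bar> * exp (- (c * u\<^sup>2))"
    proof (cases "\<bar>u\<bar> \<le> pi * \<sigma> \<kappa>")
      case True
      have "norm (indicator {- pi..pi} (u / \<sigma> \<kappa>) *\<^sub>R \<phi> \<kappa> u) \<le> norm (\<phi> \<kappa> u)"
        by (auto simp: indicator_def)
      also have "\<dots> \<le> G * exp (- (c * u\<^sup>2))" using * True by blast
      also have "\<dots> \<le> \<bar>G\<bar> * exp (- (c * u\<^sup>2))" by (intro mult_right_mono) auto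
      finally show ?thesis .
    next
      case False
      then have "u / \<sigma> \<kappa> \<notin> {- pi..pi}"
        using \<open>\<sigma> \<kappa> > 0\<close> by (auto simp: field_simps abs_le_iff)
      then show ?thesis by simp
    qed
    then show "D \<kappa> u \<le> w u"
      unfolding D_def w_def by (intro order_trans[OF norm_triangle_ineq4] add_mono) auto
  qed
  then obtain N where N: "\<And>\<kappa> u. \<kappa> \<ge> N \<Longrightarrow> D \<kappa> u \<le> w u"
    by (auto simp: eventually_sequentially)
  have "(\<lambda>\<kappa>. LINT u|lborel. D (\<kappa> + N) u) \<longlonglongrightarrow> (LINT (u::real)|lborel. (0::real))"
  proof (rule integral_dominated_convergence[where w = w and s = "\<lambda>\<kappa>. D (\<kappa> + N)"])
    show "integrable lborel w"
      unfolding w_def using integrable_gauss[OF c] integrable_gauss[of "1/2"] by simp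
    have "(\<lambda>\<kappa>. D \<kappa> u) \<longlonglongrightarrow> 0" for u
    proof -
      have "\<forall>\<^sub>F \<kappa> in sequentially. indicator {- pi..pi} (u / \<sigma> \<kappa>) = (1::real)"
        using eventually_in_region[of u 0] pos
        by eventually_elim (auto simp: field_simps abs_le_iff)
      then have "\<forall>\<^sub>F \<kappa> in sequentially. norm (\<phi> \<kappa> u - of_real (exp (- u\<^sup>2 / 2))) = D \<kappa> u"
        by eventually_elim (simp add: D_def)
      moreover have "(\<lambda>\<kappa>. norm (\<phi> \<kappa> u - of_real (exp (- u\<^sup>2 / 2)))) \<longlonglongrightarrow> 0"
        by (rule tendsto_norm_zero) (rule LIM_zero[OF cf_tendsto])
      ultimately show ?thesis by (rule Lim_transform_eventually[rotated])
    qed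
    then show "AE u in lborel. (\<lambda>\<kappa>. D (\<kappa> + N) u) \<longlonglongrightarrow> 0"
      by (intro AE_I2 LIMSEQ_ignore_initial_segment)
    show "AE u in lborel. norm (D (\<kappa> + N) u) \<le> w u" for \<kappa>
      using N[of "\<kappa> + N"] by (simp add: D_def)
  qed simp_all
  then have "(\<lambda>\<kappa>. LINT u|lborel. D (\<kappa> + N) u) \<longlonglongrightarrow> 0" by simp
  then show ?thesis
    unfolding D_def by (rule LIMSEQ_offset)
qed

definition prob_at :: "nat \<Rightarrow> int \<Rightarrow> real" where
  "prob_at \<kappa> k = measure_pmf.prob (random_permutation (n \<kappa>)) {\<tau>. sample_sum (m \<kappa>) (d \<kappa>) \<tau> = k}"

lemma prob_at_inversion:
  assumes "\<sigma> \<kappa> > 0" "m \<kappa> \<le> n \<kappa>"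
  shows "(LINT u|lborel. indicator {- pi..pi} (u / \<sigma> \<kappa>) *\<^sub>R \<phi> \<kappa> u *
      iexp (- (u * ((of_int k - real (m \<kappa>) * \<mu> \<kappa>) / \<sigma> \<kappa>)))) = of_real (2 * pi * \<sigma> \<kappa> * prob_at \<kappa> k)"
proof -
  let ?y = "of_int k - real (m \<kappa>) * \<mu> \<kappa>" and ?B = "of_nat (n \<kappa> choose m \<kappa>)"
  let ?f = "\<lambda>t. indicator {- pi..pi} t *\<^sub>R (subset_cf (m \<kappa>) (n \<kappa>) (d \<kappa>) t * iexp (- (t * ?y)))"
  have B: "(n \<kappa> choose m \<kappa>) > 0" using assms(2) by simp
  have "of_real (2 * pi * ((n \<kappa> choose m \<kappa>) * prob_at \<kappa> k)) = (LINT t|lborel. ?f t)"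
    unfolding \<mu>_def lborel_integral_subset_cf prob_at_def prob_sample_sum[OF assms(2)]
    using B by simp
  also have "\<dots> = \<bar>1 / \<sigma> \<kappa>\<bar> *\<^sub>R (LINT u|lborel. ?f (0 + 1 / \<sigma> \<kappa> * u))"
    by (rule lborel_integral_real_affine) (use assms in simp)
  also have "(LINT u|lborel. ?f (0 + 1 / \<sigma> \<kappa> * u)) = (LINT u|lborel. ?B * (indicator {- pi..pi} (u / \<sigma> \<kappa>) *\<^sub>R \<phi> \<kappa> u *
      iexp (- (u * (?y / \<sigma> \<kappa>)))))"
    using B by (intro Bochner_Integration.integral_cong) (simp_all add: \<phi>_def \<psi>_def)
  also have "\<dots> = ?B * (LINT u|lborel. indicator {- pi..pi} (u / \<sigma> \<kappa>) *\<^sub>R \<phi> \<kappa> u *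
      iexp (- (u * (?y / \<sigma> \<kappa>))))"
    by (rule integral_mult_right_zero)
  finally show ?thesis
    using assms(1) B by (simp add: scaleR_conv_of_real field_simps)
qed

text \<open>Both the probability and the Gaussian density are Fourier integrals, with kernels of modulus
  one, so their difference is at most the \<open>L\<^sup>1\<close> distance of the transforms, whatever \<open>k\<close> is.\<close>
theorem local_limit:
  "uniform_limit UNIV (\<lambda>\<kappa> k. sqrt (2 * pi) * \<sigma> \<kappa> * prob_at \<kappa> k
      - exp (- ((of_int k - real (m \<kappa>) * \<mu> \<kappa>) / \<sigma> \<kappa>)\<^sup>2 / 2)) (\<lambda>_. 0) sequentially"
proof (rule uniform_limitI)
  fix e :: real assume "e > 0"
  let ?D = "\<lambda>\<kappa>. LINT u|lborel. norm (indicator {- pi..pi} (u / \<sigma> \<kappa>) *\<^sub>R \<phi> \<kappa> u - of_real (exp (- u\<^sup>2 / 2)))"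
  have "\<forall>\<^sub>F \<kappa> in sequentially. \<sigma> \<kappa> > 0"
    by (rule eventually_sigma_pos)
  moreover have "\<forall>\<^sub>F \<kappa> in sequentially. ?D \<kappa> < e"
    using cf_L1_tendsto by (rule order_tendstoD) (use \<open>e > 0\<close> in simp)
  ultimately show "\<forall>\<^sub>F \<kappa> in sequentially. \<forall>k\<in>UNIV. dist (sqrt (2 * pi) * \<sigma> \<kappa> * prob_at \<kappa> k
      - exp (- ((of_int k - real (m \<kappa>) * \<mu> \<kappa>) / \<sigma> \<kappa>)\<^sup>2 / 2)) 0 < e"
    using eventually_ge_at_top[of 1]
  proof (eventually_elim, intro ballI)
    fix \<kappa> k assume \<sigma>: "\<sigma> \<kappa> > 0" and e: "?D \<kappa> < e" and "1 \<le> \<kappa>"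
    define x where "x = (of_int k - real (m \<kappa>) * \<mu> \<kappa>) / \<sigma> \<kappa>"
    define r where "r = sqrt (2 * pi) * \<sigma> \<kappa> * prob_at \<kappa> k - exp (- x\<^sup>2 / 2)"
    let ?f = "\<lambda>u. indicator {- pi..pi} (u / \<sigma> \<kappa>) *\<^sub>R \<phi> \<kappa> u"
    let ?g = "\<lambda>u. complex_of_real (exp (- u\<^sup>2 / 2))"
    have "integrable lborel (\<lambda>u. indicator {- (pi * \<sigma> \<kappa>)..pi * \<sigma> \<kappa>} u *\<^sub>R \<phi> \<kappa> u)"
    proof (rule borel_integrable_compact)
      have "continuous_on S (\<lambda>u. subset_cf (m \<kappa>) (n \<kappa>) (d \<kappa>) (u / \<sigma> \<kappa>))" for S
        using \<sigma> by (intro continuous_on_compose2[OF continuous_on_subset_cf[of UNIV]] continuous_intros) auto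
      then show "continuous_on {- (pi * \<sigma> \<kappa>)..pi * \<sigma> \<kappa>} (\<phi> \<kappa>)"
        unfolding \<phi>_def \<psi>_def divide_inverse by (intro continuous_on_mult continuous_on_const)
    qed simp
    also have "(\<lambda>u. indicator {- (pi * \<sigma> \<kappa>)..pi * \<sigma> \<kappa>} u *\<^sub>R \<phi> \<kappa> u) = ?f"
      using \<sigma> by (intro ext) (auto simp: indicator_def field_simps)
    finally have f: "integrable lborel ?f" .
    have g: "integrable lborel ?g"
      using integrable_gauss[of "1/2"] by (simp add: integrable_of_real)
    have mult: "integrable lborel (\<lambda>u. h u * iexp (- (u * x)))" if "integrable lborel h" for h :: "real \<Rightarrow> complex"
      by (rule Bochner_Integration.integrable_bound[OF that]) (use that in \<open>auto simp: norm_mult\<close>)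
    have "complex_of_real (sqrt (2 * pi) * r) = of_real (2 * pi * \<sigma> \<kappa> * prob_at \<kappa> k) - of_real (sqrt (2 * pi) * exp (- x\<^sup>2 / 2))"
      unfolding of_real_diff[symmetric] of_real_eq_iff
      by (simp add: r_def right_diff_distrib flip: mult.assoc)
    also have "\<dots> = (LINT u|lborel. ?f u * iexp (- (u * x))) - (LINT u|lborel. ?g u * iexp (- (u * x)))"
      unfolding x_def using \<sigma> \<open>1 \<le> \<kappa>\<close> by (simp only: prob_at_inversion m_le fourier_gauss)
    also have "\<dots> = (LINT u|lborel. ?f u * iexp (- (u * x)) - ?g u * iexp (- (u * x)))"
      by (intro Bochner_Integration.integral_diff[symmetric] mult f g)
    finally have eq: "complex_of_real (sqrt (2 * pi) * r) = (LINT u|lborel. ?f u * iexp (- (u * x)) - ?g u * iexp (- (u * x)))" .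
    have "sqrt (2 * pi) * \<bar>r\<bar> = norm (complex_of_real (sqrt (2 * pi) * r))"
      by (simp add: norm_mult)
    also have "\<dots> \<le> ?D \<kappa>"
      unfolding eq
    proof (rule Bochner_Integration.integral_norm_bound_integral)
      show "integrable lborel (\<lambda>u. ?f u * iexp (- (u * x)) - ?g u * iexp (- (u * x)))"
        by (intro Bochner_Integration.integrable_diff mult f g)
      show "integrable lborel (\<lambda>u. norm (?f u - ?g u))"
        by (intro integrable_norm Bochner_Integration.integrable_diff f g)
      show "norm (?f u * iexp (- (u * x)) - ?g u * iexp (- (u * x))) \<le> norm (?f u - ?g u)" for u
        unfolding left_diff_distrib[symmetric] norm_mult by simp
    qed
    finally have "sqrt (2 * pi) * \<bar>r\<bar> < e" using e by linarith
    moreover have "1 * \<bar>r\<bar> \<le> sqrt (2 * pi) * \<bar>r\<bar>"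
      using pi_gt3 by (intro mult_right_mono) auto
    ultimately show "dist (sqrt (2 * pi) * \<sigma> \<kappa> * prob_at \<kappa> k
      - exp (- ((of_int k - real (m \<kappa>) * \<mu> \<kappa>) / \<sigma> \<kappa>)\<^sup>2 / 2)) 0 < e"
      unfolding r_def x_def by simp
  qed
qed

end

theorem theoremA3:
  fixes n m :: "nat \<Rightarrow> nat" and d :: "nat \<Rightarrow> nat \<Rightarrow> int" and p :: "int pmf"
  assumes m_le: "\<And>\<kappa>. \<kappa> \<ge> 1 \<Longrightarrow> m \<kappa> \<le> n \<kappa>"
    and Q_pos: "\<And>\<kappa>. \<kappa> \<ge> 1 \<Longrightarrow> seq_Q (n \<kappa>) (d \<kappa>) > 0"
    and n_lim: "filterlim n at_top sequentially"
    and p_lim: "\<And>k::int. (\<lambda>\<kappa>. rel_freq (n \<kappa>) (d \<kappa>) k) \<longlonglongrightarrow> pmf p k"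
    and nonlat: "nonlattice p"
    and Q_O: "(\<lambda>\<kappa>. seq_Q (n \<kappa>) (d \<kappa>)) \<in> O(\<lambda>\<kappa>. real (n \<kappa>))"
    and lindeberg: "\<And>\<epsilon>::real. \<epsilon> > 0 \<Longrightarrow>
      (\<lambda>\<kappa>. 1 / seq_Q (n \<kappa>) (d \<kappa>) *
         (\<Sum>i | i \<in> {1..n \<kappa>} \<and>
               \<bar>real_of_int (d \<kappa> i) - seq_mean (n \<kappa>) (d \<kappa>)\<bar> > \<epsilon> * sigma_hat (m \<kappa>) (n \<kappa>) (d \<kappa>).
            (real_of_int (d \<kappa> i) - seq_mean (n \<kappa>) (d \<kappa>))\<^sup>2)) \<longlonglongrightarrow> 0"
  shows "\<exists>r :: nat \<Rightarrow> int \<Rightarrow> real.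
      uniform_limit UNIV r (\<lambda>_. 0) sequentially \<and>
      (\<forall>\<^sub>F \<kappa> in sequentially. \<forall>k::int.
        measure_pmf.prob (random_permutation (n \<kappa>)) {\<tau>. sample_sum (m \<kappa>) (d \<kappa>) \<tau> = k} =
          1 / sqrt (2 * pi * sigma_hat_sq (m \<kappa>) (n \<kappa>) (d \<kappa>)) *
          (exp (- (real_of_int k - real (m \<kappa>) * seq_mean (n \<kappa>) (d \<kappa>))\<^sup>2 /
                  (2 * sigma_hat_sq (m \<kappa>) (n \<kappa>) (d \<kappa>))) + r \<kappa> k))"
proof -
  interpret sampling_array n m d p
    using assms by unfold_locales (simp_all add: lindeberg_tail_def deviation_def)
  let ?r = "\<lambda>\<kappa> k. sqrt (2 * pi) * \<sigma> \<kappa> * prob_at \<kappa> k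
    - exp (- ((of_int k - real (m \<kappa>) * \<mu> \<kappa>) / \<sigma> \<kappa>)\<^sup>2 / 2)"
  have "\<forall>\<^sub>F \<kappa> in sequentially. \<sigma> \<kappa> > 0"
    by (rule eventually_sigma_pos)
  then have "\<forall>\<^sub>F \<kappa> in sequentially. \<forall>k::int.
        measure_pmf.prob (random_permutation (n \<kappa>)) {\<tau>. sample_sum (m \<kappa>) (d \<kappa>) \<tau> = k} =
          1 / sqrt (2 * pi * sigma_hat_sq (m \<kappa>) (n \<kappa>) (d \<kappa>)) *
          (exp (- (real_of_int k - real (m \<kappa>) * seq_mean (n \<kappa>) (d \<kappa>))\<^sup>2 /
                  (2 * sigma_hat_sq (m \<kappa>) (n \<kappa>) (d \<kappa>))) + ?r \<kappa> k)"
  proof (eventually_elim, intro allI)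
    fix \<kappa> and k :: int assume \<sigma>: "\<sigma> \<kappa> > 0"
    then have sq: "sigma_hat_sq (m \<kappa>) (n \<kappa>) (d \<kappa>) = (\<sigma> \<kappa>)\<^sup>2"
      by (simp add: \<sigma>_def sigma_hat_def)
    have exp: "- (real_of_int k - real (m \<kappa>) * \<mu> \<kappa>)\<^sup>2 / (2 * (\<sigma> \<kappa>)\<^sup>2)
        = - ((of_int k - real (m \<kappa>) * \<mu> \<kappa>) / \<sigma> \<kappa>)\<^sup>2 / 2"
      by (simp add: power_divide)
    have sqrt: "sqrt (2 * pi * (\<sigma> \<kappa>)\<^sup>2) = sqrt (2 * pi) * \<sigma> \<kappa>"
      using \<sigma> by (simp add: real_sqrt_mult)
    show "measure_pmf.prob (random_permutation (n \<kappa>)) {\<tau>. sample_sum (m \<kappa>) (d \<kappa>) \<tau> = k} =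
          1 / sqrt (2 * pi * sigma_hat_sq (m \<kappa>) (n \<kappa>) (d \<kappa>)) *
          (exp (- (real_of_int k - real (m \<kappa>) * seq_mean (n \<kappa>) (d \<kappa>))\<^sup>2 /
                  (2 * sigma_hat_sq (m \<kappa>) (n \<kappa>) (d \<kappa>))) + ?r \<kappa> k)"
      unfolding sq sqrt \<mu>_def[symmetric] exp prob_at_def[symmetric] using \<sigma> by simp
  qed
  with local_limit show ?thesis by blast
qed

end
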